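(* Let $R$ be a commutative ring with $1$, $\mathfrak G$ the matroid of a hyperplane arrangement on $[n]$ (of arbitrary rank), and $\lambda,\eta\in R^n$. Then $\eta\in Z(\lambda)$ if and only if for every line $X\in\mathcal X(\mathfrak G)$, either (i) the restrictions $\boldsymbol\lambda_X$ and $\boldsymbol\eta_X$ are parallel, or (ii) $X\in\mathcal X_0(\mathfrak G)$ and $\lambda_X\boldsymbol\eta_X=\eta_X\boldsymbol\lambda_X$.
   Context: Let $\mathcal A=\{H_1,\dots,H_n\}$ be an arrangement of distinct linear hyperplanes in $\mathbb C^\ell$ and $\mathfrak G$ its matroid on $[n]$: circuits are the minimal $C\subseteq[n]$ with $\operatorname{codim}\bigcap_{i\in C}H_i<|C|$. A line of $\mathfrak G$ is a set $X=\{k: H_k\supseteq H_i\cap H_j\}$ for some $i\ne j$ (the matroid closure of $\{i,j\}$); it is trivial if $|X|=2$. $\mathcal X(\mathfrak G)$ denotes the set of lines and $\mathcal X_0(\mathfrak G)$ the set of nontrivial lines. The Orlik–Solomon algebra $A_R(\mathfrak G)$ is the quotient of the exterior algebra over $R$ on $e_1,\dots,e_n$ by the ideal generated by $\partial e_C=\sum_{k=1}^p(-1)^{k-1}e_{i_1}\wedge\cdots\widehat{e_{i_k}}\cdots\wedge e_{i_p}$ for circuits $C=\{i_1<\dots<i_p\}$; $a_i$ is the image of $e_i$, $a_\xi=\sum_i\xi_ia_i$, and $Z(\lambda)=\{\eta\in R^n: a_\lambda\wedge a_\eta=0\}$. For $S\subseteq[n]$, $\boldsymbol\xi_S=(\xi_i)_{i\in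 S}\in R^{|S|}$ and $\xi_S=\sum_{i\in S}\xi_i$. Two vectors are parallel if all their $2\times2$ minors $\xi_i\nu_j-\xi_j\nu_i$ vanish. *)

theory Defs
  imports "HOL-Analysis.Cartesian_Space" "HOL-Algebra.QuotRing"
begin

section \<open>Arrangements, circuits and lines\<close>

definition codim :: "(complex ^ 'l) set \<Rightarrow> nat"
  where "codim V = CARD('l) - vec.dim V"

definition hyperplane :: "(complex ^ 'l) set \<Rightarrow> bool"
  where "hyperplane V \<longleftrightarrow> vec.subspace V \<and> codim V = 1"

text \<open>An arrangement is a family \<open>H\<close> of which only the values at \<open>1, \<dots>, n\<close> matter.\<close>

definition arrangement :: "nat \<Rightarrow> (nat \<Rightarrow> (complex ^ 'l) set) \<Rightarrow> bool"
  where "arrangement n H \<longleftrightarrow> (\<forall>i\<in>{1..n}. hyperplane (H i)) \<and> inj_on H {1..n}"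

definition dependent :: "nat \<Rightarrow> (nat \<Rightarrow> (complex ^ 'l) set) \<Rightarrow> nat set \<Rightarrow> bool"
  where "dependent n H C \<longleftrightarrow> C \<subseteq> {1..n} \<and> codim (\<Inter>i\<in>C. H i) < card C"

definition circuit :: "nat \<Rightarrow> (nat \<Rightarrow> (complex ^ 'l) set) \<Rightarrow> nat set \<Rightarrow> bool"
  where "circuit n H C \<longleftrightarrow> dependent n H C \<and> (\<forall>D. D \<subset> C \<longrightarrow> \<not> dependent n H D)"

definition lines :: "nat \<Rightarrow> (nat \<Rightarrow> (complex ^ 'l) set) \<Rightarrow> nat set set"
  where "lines n H =
    {X. \<exists>i\<in>{1..n}. \<exists>j\<in>{1..n}. i \<noteq> j \<and> X = {k\<in>{1..n}. H i \<inter> H j \<subseteq> H k}}"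

definition nontrivial_lines :: "nat \<Rightarrow> (nat \<Rightarrow> (complex ^ 'l) set) \<Rightarrow> nat set set"
  where "nontrivial_lines n H = {X \<in> lines n H. card X \<noteq> 2}"


section \<open>The exterior algebra\<close>

definition neg_one_pow :: "('r, 'm) ring_scheme \<Rightarrow> nat \<Rightarrow> 'r"
  where "neg_one_pow R k = (\<ominus>\<^bsub>R\<^esub> \<one>\<^bsub>R\<^esub>) [^]\<^bsub>R\<^esub> k"

definition inversions :: "nat set \<Rightarrow> nat set \<Rightarrow> nat"
  where "inversions S T = card {(s, t). s \<in> S \<and> t \<in> T \<and> t < s}"

text \<open>The exterior algebra over \<open>R\<close> on \<open>e\<^sub>1, \<dots>, e\<^sub>n\<close>. As an \<open>R\<close>-module it is free on the
  ordered monomials \<open>e\<^sub>S\<close>, the product of the \<open>e\<^sub>i\<close> for \<open>i \<in> S\<close> in increasing order, where \<open>S\<close>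
  ranges over the subsets of \<open>{1..n}\<close>; an element is the function sending \<open>S\<close> to its coefficient
  at \<open>e\<^sub>S\<close>. The product is the bilinear one with \<open>e\<^sub>S e\<^sub>T = 0\<close> if \<open>S\<close> and \<open>T\<close> meet, and otherwise
  \<open>e\<^sub>S e\<^sub>T = e\<^bsub>S \<union> T\<^esub>\<close> up to the sign of the permutation sorting \<open>S\<close> followed by \<open>T\<close>.\<close>

definition ext_alg :: "('r, 'm) ring_scheme \<Rightarrow> nat \<Rightarrow> (nat set \<Rightarrow> 'r) ring"
  where "ext_alg R n =
    \<lparr>carrier = Pow {1..n} \<rightarrow>\<^sub>E carrier R,
     mult = (\<lambda>f g. \<lambda>S\<in>Pow {1..n}. \<Oplus>\<^bsub>R\<^esub>T\<in>Pow S.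
       neg_one_pow R (inversions T (S - T)) \<otimes>\<^bsub>R\<^esub> (f T \<otimes>\<^bsub>R\<^esub> g (S - T))),
     one = (\<lambda>S\<in>Pow {1..n}. if S = {} then \<one>\<^bsub>R\<^esub> else \<zero>\<^bsub>R\<^esub>),
     zero = (\<lambda>S\<in>Pow {1..n}. \<zero>\<^bsub>R\<^esub>),
     add = (\<lambda>f g. \<lambda>S\<in>Pow {1..n}. f S \<oplus>\<^bsub>R\<^esub> g S)\<rparr>"

definition ext_scalar :: "('r, 'm) ring_scheme \<Rightarrow> nat \<Rightarrow> 'r \<Rightarrow> nat set \<Rightarrow> 'r"
  where "ext_scalar R n r = (\<lambda>S\<in>Pow {1..n}. if S = {} then r else \<zero>\<^bsub>R\<^esub>)"

definition ext_monom :: "('r, 'm) ring_scheme \<Rightarrow> nat \<Rightarrow> nat set \<Rightarrow> nat set \<Rightarrow> 'r"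
  where "ext_monom R n T = (\<lambda>S\<in>Pow {1..n}. if S = T then \<one>\<^bsub>R\<^esub> else \<zero>\<^bsub>R\<^esub>)"

definition ext_gen :: "('r, 'm) ring_scheme \<Rightarrow> nat \<Rightarrow> nat \<Rightarrow> nat set \<Rightarrow> 'r"
  where "ext_gen R n i = ext_monom R n {i}"


section \<open>The Orlik--Solomon algebra\<close>

text \<open>If \<open>i\<close> is the \<open>k\<close>-th smallest element of \<open>C\<close>, then \<open>card {j\<in>C. j < i} = k - 1\<close>.\<close>

definition ext_boundary :: "('r, 'm) ring_scheme \<Rightarrow> nat \<Rightarrow> nat set \<Rightarrow> nat set \<Rightarrow> 'r"
  where "ext_boundary R n C =
    (\<Oplus>\<^bsub>ext_alg R n\<^esub>i\<in>C. neg_one_pow (ext_alg R n) (card {j\<in>C. j < i})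
      \<otimes>\<^bsub>ext_alg R n\<^esub> ext_monom R n (C - {i}))"

definition os_ideal ::
    "('r, 'm) ring_scheme \<Rightarrow> nat \<Rightarrow> (nat \<Rightarrow> (complex ^ 'l) set) \<Rightarrow> (nat set \<Rightarrow> 'r) set"
  where "os_ideal R n H = Idl\<^bsub>ext_alg R n\<^esub> (ext_boundary R n ` {C. circuit n H C})"

definition os_alg ::
    "('r, 'm) ring_scheme \<Rightarrow> nat \<Rightarrow> (nat \<Rightarrow> (complex ^ 'l) set) \<Rightarrow> (nat set \<Rightarrow> 'r) set ring"
  where "os_alg R n H = ext_alg R n Quot os_ideal R n H"

definition os_proj ::
    "('r, 'm) ring_scheme \<Rightarrow> nat \<Rightarrow> (nat \<Rightarrow> (complex ^ 'l) set) \<Rightarrow> (nat set \<Rightarrow> 'r)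
      \<Rightarrow> (nat set \<Rightarrow> 'r) set"
  where "os_proj R n H x = os_ideal R n H +>\<^bsub>ext_alg R n\<^esub> x"

definition os_gen ::
    "('r, 'm) ring_scheme \<Rightarrow> nat \<Rightarrow> (nat \<Rightarrow> (complex ^ 'l) set) \<Rightarrow> nat \<Rightarrow> (nat set \<Rightarrow> 'r) set"
  where "os_gen R n H i = os_proj R n H (ext_gen R n i)"

text \<open>The Orlik--Solomon algebra is an \<open>R\<close>-algebra through the images of the constants
  \<^const>\<open>ext_scalar\<close>; \<open>os_vec R n H \<xi>\<close> is the element \<open>\<Sum>\<^sub>i \<xi>\<^sub>i a\<^sub>i\<close>.\<close>

definition os_vec ::
    "('r, 'm) ring_scheme \<Rightarrow> nat \<Rightarrow> (nat \<Rightarrow> (complex ^ 'l) set) \<Rightarrow> (nat \<Rightarrow> 'r) \<Rightarrow> (nat set \<Rightarrow> 'r) set"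
  where "os_vec R n H \<xi> =
    (\<Oplus>\<^bsub>os_alg R n H\<^esub>i\<in>{1..n}. os_proj R n H (ext_scalar R n (\<xi> i)) \<otimes>\<^bsub>os_alg R n H\<^esub> os_gen R n H i)"

definition os_Z ::
    "('r, 'm) ring_scheme \<Rightarrow> nat \<Rightarrow> (nat \<Rightarrow> (complex ^ 'l) set) \<Rightarrow> (nat \<Rightarrow> 'r) \<Rightarrow> (nat \<Rightarrow> 'r) set"
  where "os_Z R n H \<xi> = {\<eta> \<in> {1..n} \<rightarrow>\<^sub>E carrier R.
    os_vec R n H \<xi> \<otimes>\<^bsub>os_alg R n H\<^esub> os_vec R n H \<eta> = \<zero>\<^bsub>os_alg R n H\<^esub>}"


section \<open>Vectors over a ring\<close>

definition parallel :: "('r, 'm) ring_scheme \<Rightarrow> 'i set \<Rightarrow> ('i \<Rightarrow> 'r) \<Rightarrow> ('i \<Rightarrow> 'r) \<Rightarrow> bool"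
  where "parallel R I \<xi> \<nu> \<longleftrightarrow>
    (\<forall>i\<in>I. \<forall>j\<in>I. \<xi> i \<otimes>\<^bsub>R\<^esub> \<nu> j \<ominus>\<^bsub>R\<^esub> \<xi> j \<otimes>\<^bsub>R\<^esub> \<nu> i = \<zero>\<^bsub>R\<^esub>)"

definition vec_sum :: "('r, 'm) ring_scheme \<Rightarrow> 'i set \<Rightarrow> ('i \<Rightarrow> 'r) \<Rightarrow> 'r"
  where "vec_sum R S \<xi> = (\<Oplus>\<^bsub>R\<^esub>i\<in>S. \<xi> i)"

definition vec_smult :: "('r, 'm) ring_scheme \<Rightarrow> 'i set \<Rightarrow> 'r \<Rightarrow> ('i \<Rightarrow> 'r) \<Rightarrow> 'i \<Rightarrow> 'r"
  where "vec_smult R S r \<xi> = (\<lambda>i\<in>S. r \<otimes>\<^bsub>R\<^esub> \<xi> i)"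


section \<open>Ring structure\<close>

text \<open>\<open>ext_alg R n\<close> is a ring, so the ideal and the quotient formed above are those of
  a ring; \<open>ext_monom\<close> is the ordered product of generators, and the generators anticommute and
  square to zero.\<close>

lemma inversions_Un_left:
  assumes "finite S" "finite T" "finite U" "S \<inter> T = {}"
  shows "inversions (S \<union> T) U = inversions S U + inversions T U"
proof -
  have *: "{(s, t). s \<in> S \<union> T \<and> t \<in> U \<and> t < s} =
      {(s, t). s \<in> S \<and> t \<in> U \<and> t < s} \<union> {(s, t). s \<in> T \<and> t \<in> U \<and> t < s}" by auto
  show ?thesis
    unfolding inversions_def *
    by (rule card_Un_disjoint)
      (use assms in \<open>auto intro: finite_subset[of _ "S \<times> U"] finite_subset[of _ "T \<times> U"]\<close>)
qed

lemma inversions_Un_right: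
  assumes "finite S" "finite T" "finite U" "T \<inter> U = {}"
  shows "inversions S (T \<union> U) = inversions S T + inversions S U"
proof -
  have *: "{(s, t). s \<in> S \<and> t \<in> T \<union> U \<and> t < s} =
      {(s, t). s \<in> S \<and> t \<in> T \<and> t < s} \<union> {(s, t). s \<in> S \<and> t \<in> U \<and> t < s}" by auto
  show ?thesis
    unfolding inversions_def *
    by (rule card_Un_disjoint)
      (use assms in \<open>auto intro: finite_subset[of _ "S \<times> T"] finite_subset[of _ "S \<times> U"]\<close>)
qed

lemma inversions_empty [simp]: "inversions {} S = 0" "inversions S {} = 0"
  by (simp_all add: inversions_def)

context cring
begin

lemma neg_one_pow_closed [simp]: "neg_one_pow R k \<in> carrier R"
  by (simp add: neg_one_pow_def)

lemma neg_one_pow_add: "neg_one_pow R (k + l) = neg_one_pow R k \<otimes> neg_one_pow R l"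
  by (simp add: neg_one_pow_def nat_pow_mult)

lemma neg_one_pow_0 [simp]: "neg_one_pow R 0 = \<one>"
  by (simp add: neg_one_pow_def)

lemma finsum_Sigma:
  assumes "finite A" "\<And>x. x \<in> A \<Longrightarrow> finite (B x)"
    and "\<And>x y. x \<in> A \<Longrightarrow> y \<in> B x \<Longrightarrow> f (x, y) \<in> carrier R"
  shows "(\<Oplus>x\<in>A. \<Oplus>y\<in>B x. f (x, y)) = finsum R f (Sigma A B)"
proof -
  have "(\<Oplus>x\<in>A. \<Oplus>y\<in>B x. f (x, y)) = (\<Oplus>x\<in>A. finsum R f (Pair x ` B x))"
  proof (rule finsum_cong'[OF refl])
    show "(\<lambda>x. finsum R f (Pair x ` B x)) \<in> A \<rightarrow> carrier R"
      using assms(3) by (auto intro!: finsum_closed)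
    show "(\<Oplus>y\<in>B x. f (x, y)) = finsum R f (Pair x ` B x)" if "x \<in> A" for x
      using assms(3) that by (subst add.finprod_reindex) (auto simp: inj_on_def)
  qed
  also have "\<dots> = finsum R f (\<Union>x\<in>A. Pair x ` B x)"
    by (rule add.finprod_UN_disjoint[symmetric])
      (use assms in \<open>auto simp: pairwise_def disjnt_def\<close>)
  also have "(\<Union>x\<in>A. Pair x ` B x) = Sigma A B" by auto
  finally show ?thesis .
qed

lemma finsum_Pow_Pow:
  assumes "finite S" "\<And>T U. T \<subseteq> S \<Longrightarrow> U \<subseteq> T \<Longrightarrow> F T U \<in> carrier R"
  shows "(\<Oplus>T\<in>Pow S. \<Oplus>U\<in>Pow T. F T U) = (\<Oplus>U\<in>Pow S. \<Oplus>V\<in>Pow (S - U). F (U \<union> V) U)"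
proof -
  have "(\<Oplus>T\<in>Pow S. \<Oplus>U\<in>Pow T. F T U) = finsum R (\<lambda>(T, U). F T U) (Sigma (Pow S) Pow)"
    by (subst finsum_Sigma[symmetric]) (use assms in \<open>auto intro: finite_subset\<close>)
  also have "Sigma (Pow S) Pow = (\<lambda>(U, V). (U \<union> V, U)) ` (SIGMA U:Pow S. Pow (S - U))"
  proof (intro equalityI subsetI)
    fix x assume "x \<in> Sigma (Pow S) Pow"
    then obtain T U where "x = (T, U)" "U \<subseteq> T" "T \<subseteq> S" by auto
    then show "x \<in> (\<lambda>(U, V). (U \<union> V, U)) ` (SIGMA U:Pow S. Pow (S - U))"
      by (intro image_eqI[where x = "(U, T - U)"]) auto
  qed auto
  also have "finsum R (\<lambda>(T, U). F T U) \<dots> =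
      finsum R (\<lambda>(U, V). F (U \<union> V) U) (SIGMA U:Pow S. Pow (S - U))"
  proof (subst add.finprod_reindex)
    show "inj_on (\<lambda>(U, V). (U \<union> V, U)) (SIGMA U:Pow S. Pow (S - U))"
      by (rule inj_on_inverseI[where g = "\<lambda>(T, U). (U, T - U)"]) auto
    show "(\<lambda>(T, U). F T U) \<in> (\<lambda>(U, V). (U \<union> V, U)) ` (SIGMA U:Pow S. Pow (S - U)) \<rightarrow> carrier R"
      by (clarsimp, rule assms(2); blast)
  qed (simp add: case_prod_beta')
  also have "\<dots> = (\<Oplus>U\<in>Pow S. \<Oplus>V\<in>Pow (S - U). F (U \<union> V) U)"
  proof (subst finsum_Sigma[symmetric])
    show "(case (U, V) of (U, V) \<Rightarrow> F (U \<union> V) U) \<in> carrier R" if "U \<in> Pow S" "V \<in> Pow (S - U)" for U V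
      using that by (simp, intro assms(2)) auto
  qed (use assms(1) in auto)
  finally show ?thesis .
qed

lemma ext_coeff_closed: "f \<in> carrier (ext_alg R n) \<Longrightarrow> S \<subseteq> {1..n} \<Longrightarrow> f S \<in> carrier R"
  by (auto simp: ext_alg_def)

lemma ext_mult_closed:
  assumes "f \<in> carrier (ext_alg R n)" "g \<in> carrier (ext_alg R n)" "T \<subseteq> S" "S \<subseteq> {1..n}"
  shows "neg_one_pow R (inversions T (S - T)) \<otimes> (f T \<otimes> g (S - T)) \<in> carrier R"
proof -
  have "T \<subseteq> {1..n}" "S - T \<subseteq> {1..n}" using assms(3,4) by auto
  then show ?thesis using assms(1,2) by (intro m_closed neg_one_pow_closed ext_coeff_closed)
qed

lemma ext_mult_apply:
  "S \<subseteq> {1..n} \<Longrightarrow> (f \<otimes>\<^bsub>ext_alg R n\<^esub> g) S =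
    (\<Oplus>T\<in>Pow S. neg_one_pow R (inversions T (S - T)) \<otimes> (f T \<otimes> g (S - T)))"
  by (simp add: ext_alg_def)

lemma ext_eqI:
  "f \<in> carrier (ext_alg R n) \<Longrightarrow> g \<in> carrier (ext_alg R n) \<Longrightarrow>
    (\<And>S. S \<subseteq> {1..n} \<Longrightarrow> f S = g S) \<Longrightarrow> f = g"
  by (rule PiE_ext[where k = "Pow {1..n}" and s = "\<lambda>_. carrier R"]) (auto simp: ext_alg_def)

lemma ext_mult_carrier:
  assumes "f \<in> carrier (ext_alg R n)" "g \<in> carrier (ext_alg R n)"
  shows "f \<otimes>\<^bsub>ext_alg R n\<^esub> g \<in> carrier (ext_alg R n)"
proof -
  have "(f \<otimes>\<^bsub>ext_alg R n\<^esub> g) S \<in> carrier R" if "S \<subseteq> {1..n}" for S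
    using that assms by (auto simp: ext_mult_apply intro!: finsum_closed ext_mult_closed[of _ n])
  then show ?thesis by (auto simp: ext_alg_def)
qed

lemma ext_mult_assoc:
  assumes f: "f \<in> carrier (ext_alg R n)" and g: "g \<in> carrier (ext_alg R n)" and h: "h \<in> carrier (ext_alg R n)"
  shows "(f \<otimes>\<^bsub>ext_alg R n\<^esub> g) \<otimes>\<^bsub>ext_alg R n\<^esub> h = f \<otimes>\<^bsub>ext_alg R n\<^esub> (g \<otimes>\<^bsub>ext_alg R n\<^esub> h)"
proof (rule ext_eqI[where n = n])
  fix S assume S: "S \<subseteq> {1..n}"
  then have fin: "finite S" by (auto intro: finite_subset)
  have cl: "f T \<in> carrier R" "g T \<in> carrier R" "h T \<in> carrier R" if "T \<subseteq> S" for T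
    using that S f g h by (meson ext_coeff_closed subset_trans)+
  let ?s = "\<lambda>A B. neg_one_pow R (inversions A B)"
  let ?F = "\<lambda>T U. ?s T (S - T) \<otimes> (?s U (T - U) \<otimes> (f U \<otimes> g (T - U)) \<otimes> h (S - T))"
  have "((f \<otimes>\<^bsub>ext_alg R n\<^esub> g) \<otimes>\<^bsub>ext_alg R n\<^esub> h) S = (\<Oplus>T\<in>Pow S. \<Oplus>U\<in>Pow T. ?F T U)"
    unfolding ext_mult_apply[OF S]
  proof (rule finsum_cong')
    fix T assume "T \<in> Pow S"
    then have T: "T \<subseteq> S" by simp
    have finT: "finite T" using T fin by (rule finite_subset)
    have hc: "h (S - T) \<in> carrier R" by (rule cl) auto
    have t: "?s U (T - U) \<otimes> (f U \<otimes> g (T - U)) \<in> carrier R" if "U \<in> Pow T" for U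
      using that S T f g by (auto intro!: ext_mult_closed[of _ n])
    have "(f \<otimes>\<^bsub>ext_alg R n\<^esub> g) T = (\<Oplus>U\<in>Pow T. ?s U (T - U) \<otimes> (f U \<otimes> g (T - U)))"
      using S T by (subst ext_mult_apply) auto
    also have "\<dots> \<otimes> h (S - T) = (\<Oplus>U\<in>Pow T. ?s U (T - U) \<otimes> (f U \<otimes> g (T - U)) \<otimes> h (S - T))"
      using finT hc t by (subst finsum_ldistr) auto
    finally show "?s T (S - T) \<otimes> ((f \<otimes>\<^bsub>ext_alg R n\<^esub> g) T \<otimes> h (S - T)) = (\<Oplus>U\<in>Pow T. ?F T U)"
      using finT hc t by (simp add: finsum_rdistr)
  next
    show "(\<lambda>T. \<Oplus>U\<in>Pow T. ?F T U) \<in> Pow S \<rightarrow> carrier R"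
      by (intro funcsetI finsum_closed m_closed neg_one_pow_closed cl) auto
  qed simp
  also have "\<dots> = (\<Oplus>U\<in>Pow S. \<Oplus>V\<in>Pow (S - U). ?F (U \<union> V) U)"
    by (rule finsum_Pow_Pow[OF fin], intro m_closed neg_one_pow_closed cl) auto
  also have "\<dots> = (\<Oplus>U\<in>Pow S. ?s U (S - U) \<otimes> (f U \<otimes> (g \<otimes>\<^bsub>ext_alg R n\<^esub> h) (S - U)))"
  proof (rule finsum_cong')
    fix U assume "U \<in> Pow S"
    then have U: "U \<subseteq> S" by simp
    have fc: "f U \<in> carrier R" using U by (rule cl)
    have t: "?s V (S - U - V) \<otimes> (g V \<otimes> h (S - U - V)) \<in> carrier R" if "V \<in> Pow (S - U)" for V
      using that S g h by (intro ext_mult_closed[of _ n]) auto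
    have "?F (U \<union> V) U = ?s U (S - U) \<otimes> (f U \<otimes> (?s V (S - U - V) \<otimes> (g V \<otimes> h (S - U - V))))"
      if V: "V \<subseteq> S - U" for V
    proof -
      define W where "W = S - U - V"
      have eq: "S - (U \<union> V) = W" "U \<union> V - U = V" "S - U = V \<union> W" "S - U - V = W" "V \<union> W - V = W"
        using V by (auto simp: W_def)
      have fins: "finite U" "finite V" "finite W"
        using fin U V by (auto simp: W_def intro: finite_subset)
      have c: "g V \<in> carrier R" "h W \<in> carrier R" using V by (auto simp: W_def intro!: cl)
      have "?s (U \<union> V) W = ?s U W \<otimes> ?s V W"
        using V fins by (subst inversions_Un_left) (auto simp: neg_one_pow_add)
      moreover have "?s U (V \<union> W) = ?s U V \<otimes> ?s U W"
        using V fins by (subst inversions_Un_right) (auto simp: neg_one_pow_add W_def)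
      ultimately show ?thesis unfolding eq using c fc by (simp add: m_ac)
    qed
    then have "(\<Oplus>V\<in>Pow (S - U). ?F (U \<union> V) U) =
        (\<Oplus>V\<in>Pow (S - U). ?s U (S - U) \<otimes> (f U \<otimes> (?s V (S - U - V) \<otimes> (g V \<otimes> h (S - U - V)))))"
      using fc t by (intro finsum_cong') auto
    also have "\<dots> = ?s U (S - U) \<otimes> (f U \<otimes> (\<Oplus>V\<in>Pow (S - U). ?s V (S - U - V) \<otimes> (g V \<otimes> h (S - U - V))))"
      using fin fc t by (simp add: finsum_rdistr)
    also have "(\<Oplus>V\<in>Pow (S - U). ?s V (S - U - V) \<otimes> (g V \<otimes> h (S - U - V))) = (g \<otimes>\<^bsub>ext_alg R n\<^esub> h) (S - U)"
      using S by (subst ext_mult_apply) auto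
    finally show "(\<Oplus>V\<in>Pow (S - U). ?F (U \<union> V) U) = ?s U (S - U) \<otimes> (f U \<otimes> (g \<otimes>\<^bsub>ext_alg R n\<^esub> h) (S - U))" .
  next
    show "(\<lambda>U. ?s U (S - U) \<otimes> (f U \<otimes> (g \<otimes>\<^bsub>ext_alg R n\<^esub> h) (S - U))) \<in> Pow S \<rightarrow> carrier R"
      using f ext_mult_carrier[OF g h] S by (auto intro!: ext_mult_closed[of _ n])
  qed simp
  finally show "((f \<otimes>\<^bsub>ext_alg R n\<^esub> g) \<otimes>\<^bsub>ext_alg R n\<^esub> h) S = (f \<otimes>\<^bsub>ext_alg R n\<^esub> (g \<otimes>\<^bsub>ext_alg R n\<^esub> h)) S"
    by (simp only: ext_mult_apply[OF S])
qed (use f g h in \<open>simp_all add: ext_mult_carrier\<close>)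

lemma ext_add_apply: "S \<subseteq> {1..n} \<Longrightarrow> (f \<oplus>\<^bsub>ext_alg R n\<^esub> g) S = f S \<oplus> g S"
  by (simp add: ext_alg_def)

lemma ext_one_apply: "S \<subseteq> {1..n} \<Longrightarrow> \<one>\<^bsub>ext_alg R n\<^esub> S = (if S = {} then \<one> else \<zero>)"
  by (simp add: ext_alg_def)

lemma ext_add_carrier:
  "f \<in> carrier (ext_alg R n) \<Longrightarrow> g \<in> carrier (ext_alg R n) \<Longrightarrow> f \<oplus>\<^bsub>ext_alg R n\<^esub> g \<in> carrier (ext_alg R n)"
  by (auto simp: ext_alg_def)

lemma ext_one_carrier: "\<one>\<^bsub>ext_alg R n\<^esub> \<in> carrier (ext_alg R n)"
  by (auto simp: ext_alg_def)

lemma finsum_single: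
  assumes "finite A" "a \<in> A" "F a \<in> carrier R" "\<And>x. x \<in> A \<Longrightarrow> x \<noteq> a \<Longrightarrow> F x = \<zero>"
  shows "finsum R F A = F a"
proof -
  have "finsum R F A = (\<Oplus>x\<in>A. if a = x then F x else \<zero>)"
    by (rule finsum_cong') (use assms in auto)
  also have "\<dots> = F a"
    by (rule add.finprod_singleton) (use assms in \<open>auto, metis zero_closed\<close>)
  finally show ?thesis .
qed

lemma ext_one_mult:
  assumes f: "f \<in> carrier (ext_alg R n)"
  shows "\<one>\<^bsub>ext_alg R n\<^esub> \<otimes>\<^bsub>ext_alg R n\<^esub> f = f" "f \<otimes>\<^bsub>ext_alg R n\<^esub> \<one>\<^bsub>ext_alg R n\<^esub> = f"
proof -
  note cl = ext_coeff_closed[OF f]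
  show "\<one>\<^bsub>ext_alg R n\<^esub> \<otimes>\<^bsub>ext_alg R n\<^esub> f = f"
  proof (rule ext_eqI[where n = n])
    fix S assume S: "S \<subseteq> {1..n}"
    then have fin: "finite S" by (auto intro: finite_subset)
    have c: "f (S - T) \<in> carrier R" if "T \<subseteq> S" for T using cl S by blast
    have o: "\<one>\<^bsub>ext_alg R n\<^esub> T = (if T = {} then \<one> else \<zero>)" if "T \<subseteq> S" for T
      using that S by (intro ext_one_apply) blast
    show "(\<one>\<^bsub>ext_alg R n\<^esub> \<otimes>\<^bsub>ext_alg R n\<^esub> f) S = f S"
      unfolding ext_mult_apply[OF S]
      by (subst finsum_single[where a = "{}"]) (use fin c[of "{}"] c o in auto)
  qed (use f in \<open>auto simp: ext_mult_carrier ext_one_carrier\<close>)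
  show "f \<otimes>\<^bsub>ext_alg R n\<^esub> \<one>\<^bsub>ext_alg R n\<^esub> = f"
  proof (rule ext_eqI[where n = n])
    fix S assume S: "S \<subseteq> {1..n}"
    then have fin: "finite S" by (auto intro: finite_subset)
    have c: "f T \<in> carrier R" if "T \<subseteq> S" for T using cl S that by blast
    have o: "\<one>\<^bsub>ext_alg R n\<^esub> (S - T) = (if S - T = {} then \<one> else \<zero>)" if "T \<subseteq> S" for T
      using that S by (intro ext_one_apply) blast
    show "(f \<otimes>\<^bsub>ext_alg R n\<^esub> \<one>\<^bsub>ext_alg R n\<^esub>) S = f S"
      unfolding ext_mult_apply[OF S]
      by (subst finsum_single[where a = S]) (use fin c[of S] c o o[of S] in auto)
  qed (use f in \<open>auto simp: ext_mult_carrier ext_one_carrier\<close>)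
qed

lemma ring_ext_alg: "ring (ext_alg R n)"
proof (rule ringI)
  show "abelian_group (ext_alg R n)"
  proof (rule abelian_groupI)
    fix f assume f: "f \<in> carrier (ext_alg R n)"
    show "\<exists>g\<in>carrier (ext_alg R n). g \<oplus>\<^bsub>ext_alg R n\<^esub> f = \<zero>\<^bsub>ext_alg R n\<^esub>"
      by (rule bexI[where x = "\<lambda>S\<in>Pow {1..n}. \<ominus> f S"])
        (use ext_coeff_closed[OF f] in \<open>auto simp: ext_alg_def l_neg intro!: restrict_ext\<close>)
  next
    fix f assume f: "f \<in> carrier (ext_alg R n)"
    have "\<zero>\<^bsub>ext_alg R n\<^esub> \<in> carrier (ext_alg R n)" by (auto simp: ext_alg_def)
    then show "\<zero>\<^bsub>ext_alg R n\<^esub> \<oplus>\<^bsub>ext_alg R n\<^esub> f = f"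
      by (intro ext_eqI[where n = n] ext_add_carrier f)
        (use ext_coeff_closed[OF f] in \<open>auto simp: ext_alg_def\<close>)
  next
    show "\<zero>\<^bsub>ext_alg R n\<^esub> \<in> carrier (ext_alg R n)" by (auto simp: ext_alg_def)
  next
    fix f g h assume c: "f \<in> carrier (ext_alg R n)" "g \<in> carrier (ext_alg R n)" "h \<in> carrier (ext_alg R n)"
    show "f \<oplus>\<^bsub>ext_alg R n\<^esub> g \<oplus>\<^bsub>ext_alg R n\<^esub> h = f \<oplus>\<^bsub>ext_alg R n\<^esub> (g \<oplus>\<^bsub>ext_alg R n\<^esub> h)"
      by (intro ext_eqI[where n = n] ext_add_carrier c)
        (use c[THEN ext_coeff_closed] in \<open>simp add: ext_add_apply a_assoc\<close>)
  next
    fix f g assume c: "f \<in> carrier (ext_alg R n)" "g \<in> carrier (ext_alg R n)"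
    show "f \<oplus>\<^bsub>ext_alg R n\<^esub> g = g \<oplus>\<^bsub>ext_alg R n\<^esub> f"
      by (intro ext_eqI[where n = n] ext_add_carrier c)
        (use c[THEN ext_coeff_closed] in \<open>simp add: ext_add_apply a_comm\<close>)
  qed (rule ext_add_carrier)
next
  show "monoid (ext_alg R n)"
    by (rule monoidI) (simp_all add: ext_mult_carrier ext_one_carrier ext_mult_assoc ext_one_mult)
next
  fix f g h assume c: "f \<in> carrier (ext_alg R n)" "g \<in> carrier (ext_alg R n)" "h \<in> carrier (ext_alg R n)"
  have cl: "f T \<in> carrier R" "g T \<in> carrier R" "h T \<in> carrier R"
      "f (S - T) \<in> carrier R" "g (S - T) \<in> carrier R" "h (S - T) \<in> carrier R"
      "(f \<oplus>\<^bsub>ext_alg R n\<^esub> g) T = f T \<oplus> g T" "(f \<oplus>\<^bsub>ext_alg R n\<^esub> g) (S - T) = f (S - T) \<oplus> g (S - T)"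
    if "S \<subseteq> {1..n}" "T \<in> Pow S" for S T
    using that c[THEN ext_coeff_closed] by (auto simp: subset_iff intro!: ext_add_apply)
  show "(f \<oplus>\<^bsub>ext_alg R n\<^esub> g) \<otimes>\<^bsub>ext_alg R n\<^esub> h =
      f \<otimes>\<^bsub>ext_alg R n\<^esub> h \<oplus>\<^bsub>ext_alg R n\<^esub> g \<otimes>\<^bsub>ext_alg R n\<^esub> h"
  proof (intro ext_eqI[where n = n] ext_add_carrier ext_mult_carrier c)
    fix S assume S: "S \<subseteq> {1..n}"
    show "((f \<oplus>\<^bsub>ext_alg R n\<^esub> g) \<otimes>\<^bsub>ext_alg R n\<^esub> h) S =
      (f \<otimes>\<^bsub>ext_alg R n\<^esub> h \<oplus>\<^bsub>ext_alg R n\<^esub> g \<otimes>\<^bsub>ext_alg R n\<^esub> h) S"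
    proof -
      have "(\<Oplus>T\<in>Pow S. neg_one_pow R (inversions T (S - T)) \<otimes> ((f \<oplus>\<^bsub>ext_alg R n\<^esub> g) T \<otimes> h (S - T))) =
          (\<Oplus>T\<in>Pow S. neg_one_pow R (inversions T (S - T)) \<otimes> (f T \<otimes> h (S - T)) \<oplus> neg_one_pow R (inversions T (S - T)) \<otimes> (g T \<otimes> h (S - T)))"
        by (rule finsum_cong'[OF refl]) (use cl[OF S] in \<open>simp_all add: Pi_iff l_distr r_distr\<close>)
      also have "\<dots> = (\<Oplus>T\<in>Pow S. neg_one_pow R (inversions T (S - T)) \<otimes> (f T \<otimes> h (S - T))) \<oplus> (\<Oplus>T\<in>Pow S. neg_one_pow R (inversions T (S - T)) \<otimes> (g T \<otimes> h (S - T)))"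
        by (rule finsum_addf) (use cl[OF S] in \<open>simp_all add: Pi_iff\<close>)
      finally show ?thesis unfolding ext_add_apply[OF S] ext_mult_apply[OF S] .
    qed
  qed
  have cl: "f T \<in> carrier R" "g T \<in> carrier R" "h T \<in> carrier R"
      "f (S - T) \<in> carrier R" "g (S - T) \<in> carrier R" "h (S - T) \<in> carrier R"
      "(f \<oplus>\<^bsub>ext_alg R n\<^esub> g) T = f T \<oplus> g T" "(f \<oplus>\<^bsub>ext_alg R n\<^esub> g) (S - T) = f (S - T) \<oplus> g (S - T)"
    if "S \<subseteq> {1..n}" "T \<in> Pow S" for S T
    using that c[THEN ext_coeff_closed] by (auto simp: subset_iff intro!: ext_add_apply)
  show "h \<otimes>\<^bsub>ext_alg R n\<^esub> (f \<oplus>\<^bsub>ext_alg R n\<^esub> g) =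
      h \<otimes>\<^bsub>ext_alg R n\<^esub> f \<oplus>\<^bsub>ext_alg R n\<^esub> h \<otimes>\<^bsub>ext_alg R n\<^esub> g"
  proof (intro ext_eqI[where n = n] ext_add_carrier ext_mult_carrier c)
    fix S assume S: "S \<subseteq> {1..n}"
    show "(h \<otimes>\<^bsub>ext_alg R n\<^esub> (f \<oplus>\<^bsub>ext_alg R n\<^esub> g)) S =
      (h \<otimes>\<^bsub>ext_alg R n\<^esub> f \<oplus>\<^bsub>ext_alg R n\<^esub> h \<otimes>\<^bsub>ext_alg R n\<^esub> g) S"
    proof -
      have "(\<Oplus>T\<in>Pow S. neg_one_pow R (inversions T (S - T)) \<otimes> (h T \<otimes> (f \<oplus>\<^bsub>ext_alg R n\<^esub> g) (S - T))) =
          (\<Oplus>T\<in>Pow S. neg_one_pow R (inversions T (S - T)) \<otimes> (h T \<otimes> f (S - T)) \<oplus> neg_one_pow R (inversions T (S - T)) \<otimes> (h T \<otimes> g (S - T)))"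
        by (rule finsum_cong'[OF refl]) (use cl[OF S] in \<open>simp_all add: Pi_iff l_distr r_distr\<close>)
      also have "\<dots> = (\<Oplus>T\<in>Pow S. neg_one_pow R (inversions T (S - T)) \<otimes> (h T \<otimes> f (S - T))) \<oplus> (\<Oplus>T\<in>Pow S. neg_one_pow R (inversions T (S - T)) \<otimes> (h T \<otimes> g (S - T)))"
        by (rule finsum_addf) (use cl[OF S] in \<open>simp_all add: Pi_iff\<close>)
      finally show ?thesis unfolding ext_add_apply[OF S] ext_mult_apply[OF S] .
    qed
  qed
qed

lemma ext_monom_carrier: "ext_monom R n S \<in> carrier (ext_alg R n)"
  by (auto simp: ext_alg_def ext_monom_def)

lemma ext_monom_mult:
  assumes "S \<union> T \<subseteq> {1..n}"
  shows "ext_monom R n S \<otimes>\<^bsub>ext_alg R n\<^esub> ext_monom R n T =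
    (if S \<inter> T = {} then \<lambda>U\<in>Pow {1..n}. if U = S \<union> T then neg_one_pow R (inversions S T) else \<zero>
     else \<zero>\<^bsub>ext_alg R n\<^esub>)" (is "_ = ?r")
proof (rule ext_eqI[where n = n])
  fix U assume U: "U \<subseteq> {1..n}"
  have fin: "finite U" using U by (auto intro: finite_subset)
  show "(ext_monom R n S \<otimes>\<^bsub>ext_alg R n\<^esub> ext_monom R n T) U = ?r U"
  proof (cases "S \<subseteq> U")
    case True
    have "(ext_monom R n S \<otimes>\<^bsub>ext_alg R n\<^esub> ext_monom R n T) U =
        neg_one_pow R (inversions S (U - S)) \<otimes> (ext_monom R n S S \<otimes> ext_monom R n T (U - S))"
      unfolding ext_mult_apply[OF U]
    proof (rule finsum_single)
      fix x assume "x \<in> Pow U" "x \<noteq> S"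
      moreover from this have "x \<subseteq> {1..n}" "U - x \<subseteq> {1..n}" using U by auto
      ultimately show "neg_one_pow R (inversions x (U - x)) \<otimes> (ext_monom R n S x \<otimes> ext_monom R n T (U - x)) = \<zero>"
        by (simp add: ext_monom_def)
    qed (use fin True U in \<open>simp_all add: ext_mult_closed[OF ext_monom_carrier ext_monom_carrier _ U]\<close>)
    moreover have "U - S \<subseteq> {1..n}" using U by auto
    moreover have "U - S = T \<longleftrightarrow> U = S \<union> T \<and> S \<inter> T = {}" using True by auto
    ultimately show ?thesis using U assms by (auto simp: ext_monom_def ext_alg_def)
  next
    case False
    have "(ext_monom R n S \<otimes>\<^bsub>ext_alg R n\<^esub> ext_monom R n T) U = \<zero>"
      unfolding ext_mult_apply[OF U]
    proof (rule add.finprod_one_eqI)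
      fix x assume "x \<in> Pow U"
      moreover from this have "x \<subseteq> {1..n}" "U - x \<subseteq> {1..n}" "x \<noteq> S" using U False by auto
      ultimately show "neg_one_pow R (inversions x (U - x)) \<otimes> (ext_monom R n S x \<otimes> ext_monom R n T (U - x)) = \<zero>"
        by (simp add: ext_monom_def)
    qed
    then show ?thesis using U False by (auto simp: ext_alg_def)
  qed
qed (auto intro!: ext_mult_carrier ext_monom_carrier, auto simp: ext_alg_def)

lemma ext_monom_insert:
  assumes "insert i S \<subseteq> {1..n}" "\<forall>j\<in>S. i < j"
  shows "ext_monom R n (insert i S) = ext_gen R n i \<otimes>\<^bsub>ext_alg R n\<^esub> ext_monom R n S"
proof -
  have "{(s, t). s \<in> {i} \<and> t \<in> S \<and> t < s} = {}" using assms(2) by fastforce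
  then have "inversions {i} S = 0" unfolding inversions_def by (simp only: card.empty)
  moreover have "i \<notin> S" using assms(2) by auto
  ultimately show ?thesis
    unfolding ext_gen_def using assms(1)
    by (subst ext_monom_mult) (auto simp: ext_monom_def)
qed

lemma ext_gen_square:
  "i \<in> {1..n} \<Longrightarrow> ext_gen R n i \<otimes>\<^bsub>ext_alg R n\<^esub> ext_gen R n i = \<zero>\<^bsub>ext_alg R n\<^esub>"
  unfolding ext_gen_def by (subst ext_monom_mult) auto

lemma ext_gen_anticomm:
  assumes "i \<in> {1..n}" "j \<in> {1..n}"
  shows "ext_gen R n i \<otimes>\<^bsub>ext_alg R n\<^esub> ext_gen R n j \<oplus>\<^bsub>ext_alg R n\<^esub>
    ext_gen R n j \<otimes>\<^bsub>ext_alg R n\<^esub> ext_gen R n i = \<zero>\<^bsub>ext_alg R n\<^esub>"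
proof (cases "i = j")
  case True
  then show ?thesis using assms by (simp add: ext_gen_square) (auto simp: ext_alg_def intro!: restrict_ext)
next
  case False
  have i: "inversions {i} {j} = (if j < i then 1 else 0)" for i j
  proof -
    have "{(s, t). s \<in> {i} \<and> t \<in> {j} \<and> t < s} = (if j < i then {(i, j)} else {})" by auto
    then show ?thesis by (simp add: inversions_def)
  qed
  have *: "neg_one_pow R (inversions {i} {j}) \<oplus> neg_one_pow R (inversions {j} {i}) = \<zero>"
    using False unfolding i by (simp add: neg_one_pow_def l_neg r_neg)
  have "{j} \<union> {i} = {i} \<union> {j}" by auto
  with * assms False show ?thesis
    unfolding ext_gen_def by (simp add: ext_monom_mult) (auto simp: ext_alg_def intro!: restrict_ext)
qed

lemma ideal_os_ideal: "ideal (os_ideal R n H) (ext_alg R n)"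
proof -
  interpret E: ring "ext_alg R n" by (rule ring_ext_alg)
  have "neg_one_pow (ext_alg R n) k \<in> carrier (ext_alg R n)" for k
    unfolding neg_one_pow_def by (intro E.nat_pow_closed E.a_inv_closed E.one_closed)
  then have "ext_boundary R n C \<in> carrier (ext_alg R n)" for C
    unfolding ext_boundary_def by (intro E.finsum_closed funcsetI E.m_closed ext_monom_carrier)
  then show ?thesis
    unfolding os_ideal_def by (intro E.genideal_ideal image_subsetI)
qed

end

end

theory Submission
  imports Defs "HOL-Algebra.Multiplicative_Group"
begin

text \<open>Circuits have at least three elements and every pair of indices lies on exactly one line,
  so in degree two the Orlik--Solomon relations split along the lines. On a line \<open>X\<close>
  they are the boundaries of triples, which span the kernel of the boundary map
  \<open>e\<^sub>i e\<^sub>j \<mapsto> e\<^sub>j - e\<^sub>i\<close>. Hence \<open>a\<^sub>\<lambda> a\<^sub>\<eta> = 0\<close> iff the boundary of the \<open>X\<close>-component of \<open>e\<^sub>\<lambda> e\<^sub>\<eta>\<close>, that is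
  \<open>\<lambda>\<^sub>X \<eta> - \<eta>\<^sub>X \<lambda>\<close> restricted to \<open>X\<close>, vanishes for every line \<open>X\<close>. This equation is implied by
  parallelism and equivalent to it if \<open>card X = 2\<close>.\<close>

section \<open>Sums in rings\<close>

text \<open>The two directions use different halves of the exactness on a line. If the product
  vanishes, it is enough to enclose the Orlik-Solomon ideal in an ideal on which the boundaries of
  all line components vanish. That vanishing alone does not cut out an ideal, since the constant 1
  satisfies it; so vanishing in degrees 0 and 1 is imposed as well, which the boundary of a circuit
  satisfies because its terms have degree at least two. Conversely, instead of showing that
  boundaries of triples span a kernel, the triple relations are rewritten in the quotient as a_i a_j
  = (a_i - a_j) a_m with a fixed index m of the line. A product of two vectors supported on the line
  then acquires the right factor a_m, and its cofactor is the negative of the boundary, hence zero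
  by assumption. No step divides or cancels a factor in \<open>R\<close>, so zero divisors do no
  harm.\<close>

lemma (in ring_hom_ring) hom_finsum:
  assumes "finite A" "f \<in> A \<rightarrow> carrier R"
  shows "h (finsum R f A) = (\<Oplus>\<^bsub>S\<^esub>i\<in>A. h (f i))"
  using assms
proof (induction A rule: finite_induct)
  case (insert x A)
  then have "f \<in> A \<rightarrow> carrier R" "f x \<in> carrier R"
    "(\<lambda>i. h (f i)) \<in> A \<rightarrow> carrier S" "h (f x) \<in> carrier S"
    by (auto simp: Pi_iff)
  with insert show ?case by simp
qed simp

lemma (in ideal) finsum_mem:
  "finite A \<Longrightarrow> f \<in> A \<rightarrow> I \<Longrightarrow> finsum R f A \<in> I"
proof (induction A rule: finite_induct)
  case (insert x A)
  then have "f \<in> A \<rightarrow> carrier R" "f x \<in> carrier R" by (auto intro: Icarr)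
  with insert show ?case by (auto intro: a_closed)
qed simp

context ring
begin

lemma finsum_product:
  assumes "finite A" "finite B" "f \<in> A \<rightarrow> carrier R" "g \<in> B \<rightarrow> carrier R"
  shows "finsum R f A \<otimes> finsum R g B = (\<Oplus>p\<in>A \<times> B. f (fst p) \<otimes> g (snd p))"
  using assms(1,3)
proof (induction A rule: finite_induct)
  case empty
  then show ?case using assms by simp
next
  case (insert x A)
  have "insert x A \<times> B = Pair x ` B \<union> A \<times> B" by auto
  then have "(\<Oplus>p\<in>insert x A \<times> B. f (fst p) \<otimes> g (snd p)) =
      (\<Oplus>p\<in>Pair x ` B. f (fst p) \<otimes> g (snd p)) \<oplus> (\<Oplus>p\<in>A \<times> B. f (fst p) \<otimes> g (snd p))"
    using insert assms by (auto simp: Pi_iff intro!: add.finprod_Un_disjoint)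
  also have "(\<Oplus>p\<in>Pair x ` B. f (fst p) \<otimes> g (snd p)) = (\<Oplus>j\<in>B. f x \<otimes> g j)"
    using insert assms by (subst add.finprod_reindex) (auto simp: inj_on_def Pi_iff)
  also have "\<dots> = f x \<otimes> finsum R g B"
    using insert assms by (subst finsum_rdistr) auto
  finally show ?case
    using insert assms by (simp add: l_distr Pi_iff)
qed

text \<open>\<open>L\<close> is the set of lines of a linear space on the points \<open>N\<close>; the off-diagonal parts
  of the squares of the lines partition that of \<open>N\<close>.\<close>

lemma finsum_product_linear_space:
  assumes N: "finite N" "f \<in> N \<rightarrow> carrier R" "g \<in> N \<rightarrow> carrier R"
    and diag: "\<And>i. i \<in> N \<Longrightarrow> f i \<otimes> g i = \<zero>"
    and sub: "\<And>X. X \<in> L \<Longrightarrow> X \<subseteq> N"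
    and ex: "\<And>i j. i \<in> N \<Longrightarrow> j \<in> N \<Longrightarrow> i \<noteq> j \<Longrightarrow> \<exists>X\<in>L. i \<in> X \<and> j \<in> X"
    and unique: "\<And>X Y i j. X \<in> L \<Longrightarrow> Y \<in> L \<Longrightarrow> i \<in> X \<inter> Y \<Longrightarrow> j \<in> X \<inter> Y \<Longrightarrow> i \<noteq> j \<Longrightarrow> X = Y"
  shows "finsum R f N \<otimes> finsum R g N = (\<Oplus>X\<in>L. finsum R f X \<otimes> finsum R g X)"
proof -
  let ?F = "\<lambda>p. f (fst p) \<otimes> g (snd p)"
  define P where "P X = X \<times> X - Id" for X :: "'c set"
  have F: "?F p \<in> carrier R" if "p \<in> N \<times> N" for p
    using that N by (auto intro!: m_closed simp: Pi_iff)
  have *: "finsum R f X \<otimes> finsum R g X = finsum R ?F (P X)" if X: "X \<subseteq> N" for X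
  proof -
    have "finsum R f X \<otimes> finsum R g X = finsum R ?F (X \<times> X)"
      using X N finite_subset[OF X] by (intro finsum_product) auto
    also have "\<dots> = finsum R ?F (P X)"
    proof (rule add.finprod_mono_neutral_cong_right)
      show "?F p = \<zero>\<^bsub>R\<^esub>" if "p \<in> X \<times> X - P X" for p
        using that X diag by (auto simp: P_def)
      show "?F \<in> X \<times> X \<rightarrow> carrier R" using X F by auto
    qed (use X N in \<open>auto simp: P_def intro: finite_subset\<close>)
    finally show ?thesis .
  qed
  have PN: "P N = (\<Union>X\<in>L. P X)"
    using sub ex by (fastforce simp: P_def)
  have "finsum R f N \<otimes> finsum R g N = finsum R ?F (\<Union>X\<in>L. P X)"
    using * PN by simp
  also have "\<dots> = (\<Oplus>X\<in>L. finsum R ?F (P X))"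
  proof (rule add.finprod_UN_disjoint)
    show "finite L" using sub N(1) by (meson PowI finite_Pow_iff finite_subset subsetI)
    show "finite (P X)" if "X \<in> L" for X
      using finite_subset[OF sub[OF that] N(1)] by (simp add: P_def)
    show "?F x \<in> carrier R" if "X \<in> L" "x \<in> P X" for X x
      using sub[OF that(1)] that(2) by (intro F) (auto simp: P_def)
    show "pairwise (\<lambda>X Y. disjnt (P X) (P Y)) L"
      using unique by (fastforce simp: pairwise_def disjnt_def P_def)
  qed
  also have "\<dots> = (\<Oplus>X\<in>L. finsum R f X \<otimes> finsum R g X)"
    using sub N by (intro finsum_cong') (auto simp: * intro!: m_closed finsum_closed)
  finally show ?thesis .
qed

text \<open>Writing \<open>u\<close>, \<open>v\<close> for the two factors and \<open>S\<close>, \<open>T\<close> for the sums of \<open>s\<close>, \<open>t\<close>, the relation between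
  the \<open>a i\<close> gives \<open>a i v = (T a i - v) a m\<close>, hence \<open>u v = (T u - S v) a m\<close>, and \<open>T u = S v\<close>.\<close>

lemma finsum_product_pencil:
  assumes X: "finite X" "m \<in> X"
    and a: "a \<in> X \<rightarrow> carrier R" and s: "s \<in> X \<rightarrow> carrier R" and t: "t \<in> X \<rightarrow> carrier R"
    and comm: "\<And>i j. i \<in> X \<Longrightarrow> j \<in> X \<Longrightarrow> a i \<otimes> t j = t j \<otimes> a i"
    and pencil: "\<And>i j. i \<in> X \<Longrightarrow> j \<in> X \<Longrightarrow> a i \<otimes> a j = (a i \<ominus> a j) \<otimes> a m"
    and eq: "\<And>i. i \<in> X \<Longrightarrow> finsum R s X \<otimes> t i = finsum R t X \<otimes> s i"
    and comm': "\<And>i. i \<in> X \<Longrightarrow> s i \<otimes> finsum R t X = finsum R t X \<otimes> s i"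
  shows "(\<Oplus>i\<in>X. s i \<otimes> a i) \<otimes> (\<Oplus>j\<in>X. t j \<otimes> a j) = \<zero>"
proof -
  define S T u v where "S = finsum R s X" and "T = finsum R t X"
    and "u = (\<Oplus>i\<in>X. s i \<otimes> a i)" and "v = (\<Oplus>j\<in>X. t j \<otimes> a j)"
  have cl [simp]: "a i \<in> carrier R" "s i \<in> carrier R" "t i \<in> carrier R" if "i \<in> X" for i
    using that a s t by auto
  have clS [simp]: "S \<in> carrier R" "T \<in> carrier R" "u \<in> carrier R" "v \<in> carrier R"
    by (auto simp: S_def T_def u_def v_def intro!: finsum_closed)
  have av: "a i \<otimes> v = (T \<otimes> a i \<ominus> v) \<otimes> a m" if i: "i \<in> X" for i
  proof -
    have "a i \<otimes> v = (\<Oplus>j\<in>X. a i \<otimes> (t j \<otimes> a j))"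
      using X i unfolding v_def by (intro finsum_rdistr) auto
    also have "\<dots> = (\<Oplus>j\<in>X. (t j \<otimes> a i \<oplus> \<ominus> (t j \<otimes> a j)) \<otimes> a m)"
    proof (rule finsum_cong'[OF refl])
      fix j assume j: "j \<in> X"
      have "a i \<otimes> (t j \<otimes> a j) = t j \<otimes> (a i \<otimes> a j)"
        using i j comm by (simp flip: m_assoc)
      also have "\<dots> = (t j \<otimes> (a i \<ominus> a j)) \<otimes> a m"
        using i j X by (simp add: pencil m_assoc)
      finally show "a i \<otimes> (t j \<otimes> a j) = (t j \<otimes> a i \<oplus> \<ominus> (t j \<otimes> a j)) \<otimes> a m"
        using i j by (simp add: minus_eq r_distr r_minus)
    qed (use i X in auto)
    also have "\<dots> = (\<Oplus>j\<in>X. t j \<otimes> a i \<oplus> \<ominus> (t j \<otimes> a j)) \<otimes> a m"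
      using X i by (intro finsum_ldistr[symmetric]) auto
    also have "(\<Oplus>j\<in>X. t j \<otimes> a i \<oplus> \<ominus> (t j \<otimes> a j)) =
        (\<Oplus>j\<in>X. t j \<otimes> a i) \<oplus> (\<Oplus>j\<in>X. \<ominus> (t j \<otimes> a j))"
      using i by (intro finsum_addf) auto
    also have "(\<Oplus>j\<in>X. t j \<otimes> a i) = T \<otimes> a i"
      unfolding T_def using X i by (intro finsum_ldistr[symmetric]) auto
    \<comment> \<open>Negation becomes multiplication by minus one, so that distributivity handles
      the sum.\<close>
    also have "(\<Oplus>j\<in>X. \<ominus> (t j \<otimes> a j)) = (\<Oplus>j\<in>X. \<ominus> \<one> \<otimes> (t j \<otimes> a j))"
      by (intro finsum_cong') (auto simp: l_minus)
    also have "\<dots> = \<ominus> \<one> \<otimes> v"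
      unfolding v_def using X by (intro finsum_rdistr[symmetric]) auto
    also have "\<dots> = \<ominus> v" by (simp add: l_minus)
    finally show ?thesis by (simp add: minus_eq)
  qed
  have "u \<otimes> v = (\<Oplus>i\<in>X. (s i \<otimes> a i) \<otimes> v)"
    unfolding u_def using X by (intro finsum_ldistr) auto
  also have "\<dots> = (\<Oplus>i\<in>X. (s i \<otimes> (T \<otimes> a i) \<oplus> s i \<otimes> \<ominus> v) \<otimes> a m)"
  proof (rule finsum_cong'[OF refl])
    fix i assume i: "i \<in> X"
    have "(s i \<otimes> a i) \<otimes> v = s i \<otimes> ((T \<otimes> a i \<ominus> v) \<otimes> a m)"
      using i by (simp add: m_assoc av)
    then show "(s i \<otimes> a i) \<otimes> v = (s i \<otimes> (T \<otimes> a i) \<oplus> s i \<otimes> \<ominus> v) \<otimes> a m"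
      using i X by (simp add: minus_eq r_distr flip: m_assoc)
  qed (use X in auto)
  also have "\<dots> = (\<Oplus>i\<in>X. s i \<otimes> (T \<otimes> a i) \<oplus> s i \<otimes> \<ominus> v) \<otimes> a m"
    using X by (intro finsum_ldistr[symmetric]) auto
  also have "(\<Oplus>i\<in>X. s i \<otimes> (T \<otimes> a i) \<oplus> s i \<otimes> \<ominus> v) =
      (\<Oplus>i\<in>X. s i \<otimes> (T \<otimes> a i)) \<oplus> (\<Oplus>i\<in>X. s i \<otimes> \<ominus> v)"
    by (intro finsum_addf) auto
  also have "(\<Oplus>i\<in>X. s i \<otimes> \<ominus> v) = S \<otimes> \<ominus> v"
    unfolding S_def using X by (intro finsum_ldistr[symmetric]) auto
  \<comment> \<open>\<open>comm'\<close> moves \<open>T\<close> to the left of \<open>s i\<close>;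
    then \<open>eq\<close> turns \<open>T\<close> times \<open>s i\<close> into \<open>S\<close>
    times \<open>t i\<close>.\<close>
  also have "(\<Oplus>i\<in>X. s i \<otimes> (T \<otimes> a i)) = (\<Oplus>i\<in>X. S \<otimes> (t i \<otimes> a i))"
    by (intro finsum_cong') (use comm' eq in \<open>auto simp: S_def[symmetric] T_def[symmetric] simp flip: m_assoc\<close>)
  also have "\<dots> = S \<otimes> v"
    unfolding v_def using X by (intro finsum_rdistr[symmetric]) auto
  also have "S \<otimes> v \<oplus> S \<otimes> \<ominus> v = \<zero>" by (simp add: r_minus r_neg)
  finally show ?thesis using X by (simp add: u_def v_def)
qed

end


section \<open>Lines and circuits of an arrangement\<close>

lemma dim_le_CARD: "vec.dim (V :: (complex ^ 'l) set) \<le> CARD('l)"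
  by (metis vec.dim_subset subset_UNIV vec_dim_card)

lemma dim_hyperplane:
  "hyperplane (V :: (complex ^ 'l) set) \<Longrightarrow> Suc (vec.dim V) = CARD('l)"
  by (auto simp: hyperplane_def codim_def)

text \<open>The sum of two distinct hyperplanes is strictly larger than each of them, hence the
  whole space, and the dimension formula for sums gives the intersection. The additive form avoids
  truncated subtraction.\<close>

lemma dim_hyperplane_Int:
  fixes U V :: "(complex ^ 'l) set"
  assumes U: "hyperplane U" and V: "hyperplane V" and "U \<noteq> V"
  shows "vec.dim (U \<inter> V) + 2 = CARD('l)"
proof -
  have sub: "vec.subspace U" "vec.subspace V"
    using U V by (auto simp: hyperplane_def)
  let ?W = "{x + y | x y. x \<in> U \<and> y \<in> V}"
  have "0 \<in> U" "0 \<in> V" using sub by (auto simp: vec.subspace_def)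
  then have "U \<subseteq> ?W" "V \<subseteq> ?W" by force+
  have "vec.subspace ?W" by (rule vec.subspace_sums[OF sub])
  have "\<not> vec.dim ?W \<le> vec.dim U"
  proof
    assume *: "vec.dim ?W \<le> vec.dim U"
    then have "U = ?W"
      using sub \<open>vec.subspace ?W\<close> \<open>U \<subseteq> ?W\<close> by (intro vec.subspace_dim_equal)
    moreover have "V = ?W"
      using sub \<open>vec.subspace ?W\<close> \<open>V \<subseteq> ?W\<close> * dim_hyperplane[OF U] dim_hyperplane[OF V]
      by (intro vec.subspace_dim_equal) auto
    ultimately have "U = V" by (rule trans[OF _ sym])
    then show False using \<open>U \<noteq> V\<close> by contradiction
  qed
  then show ?thesis
    using vec.dim_sums_Int[OF sub] dim_hyperplane[OF U] dim_hyperplane[OF V]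
      dim_le_CARD[of ?W] by linarith
qed

context
  fixes n :: nat and H :: "nat \<Rightarrow> (complex ^ 'l) set"
  assumes arr: "arrangement n H"
begin

lemma arrangement_hyperplane: "i \<in> {1..n} \<Longrightarrow> hyperplane (H i)"
  using arr by (auto simp: arrangement_def)

lemma arrangement_dim_Int:
  assumes "i \<in> {1..n}" "j \<in> {1..n}" "i \<noteq> j"
  shows "vec.dim (H i \<inter> H j) + 2 = CARD('l)"
proof (intro dim_hyperplane_Int arrangement_hyperplane assms)
  show "H i \<noteq> H j"
    using arr assms inj_onD[of H "{1..n}" i j] unfolding arrangement_def by blast
qed

lemma arrangement_subspace_Int:
  "i \<in> {1..n} \<Longrightarrow> j \<in> {1..n} \<Longrightarrow> vec.subspace (H i \<inter> H j)"
  using arrangement_hyperplane by (auto simp: hyperplane_def intro!: vec.subspace_inter)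

lemma lines_subset: "X \<in> lines n H \<Longrightarrow> X \<subseteq> {1..n}"
  by (auto simp: lines_def)

lemma finite_line: "X \<in> lines n H \<Longrightarrow> finite X"
  by (meson lines_subset finite_atLeastAtMost finite_subset)

text \<open>Any two points of a line determine it: the intersection defining the line lies in
  \<open>H i \<inter> H j\<close>, and both have codimension two, so they coincide.\<close>

lemma line_eq:
  assumes X: "X \<in> lines n H" and "i \<in> X" "j \<in> X" "i \<noteq> j"
  shows "X = {k\<in>{1..n}. H i \<inter> H j \<subseteq> H k}"
proof -
  obtain p q where pq: "p \<in> {1..n}" "q \<in> {1..n}" "p \<noteq> q"
    and XX: "X = {k\<in>{1..n}. H p \<inter> H q \<subseteq> H k}"
    using X by (auto simp: lines_def)
  have ij: "i \<in> {1..n}" "j \<in> {1..n}" "H p \<inter> H q \<subseteq> H i \<inter> H j"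
    using assms XX by auto
  have "H p \<inter> H q = H i \<inter> H j"
    using ij pq \<open>i \<noteq> j\<close> arrangement_dim_Int[of i j] arrangement_dim_Int[of p q]
    by (intro vec.subspace_dim_equal arrangement_subspace_Int) auto
  then show ?thesis using XX by simp
qed

lemma line_through:
  assumes "i \<in> {1..n}" "j \<in> {1..n}" "i \<noteq> j"
  obtains X where "X \<in> lines n H" "i \<in> X" "j \<in> X"
proof
  show "{k\<in>{1..n}. H i \<inter> H j \<subseteq> H k} \<in> lines n H"
    unfolding lines_def mem_Collect_eq by (rule bexI[of _ i], rule bexI[of _ j]) (use assms in simp_all)
qed (use assms in auto)

lemma lines_Int_unique:
  assumes "X \<in> lines n H" "Y \<in> lines n H" "i \<in> X \<inter> Y" "j \<in> X \<inter> Y" "i \<noteq> j"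
  shows "X = Y"
proof -
  have "X = {k\<in>{1..n}. H i \<inter> H j \<subseteq> H k}" "Y = {k\<in>{1..n}. H i \<inter> H j \<subseteq> H k}"
    by (rule line_eq[of _ i j]; use assms in blast)+
  then show ?thesis by (rule trans[OF _ sym])
qed

lemma card_line_ge: "X \<in> lines n H \<Longrightarrow> 2 \<le> card X"
proof -
  assume X: "X \<in> lines n H"
  then obtain i j where ij: "i \<in> {1..n}" "j \<in> {1..n}" "i \<noteq> j"
    and XX: "X = {k\<in>{1..n}. H i \<inter> H j \<subseteq> H k}"
    by (auto simp: lines_def)
  have "{i, j} \<subseteq> X" unfolding XX using ij by auto
  then have "card {i, j} \<le> card X" by (rule card_mono[OF finite_line[OF X]])
  then show ?thesis using ij(3) by simp
qed

lemma card_dependent_ge: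
  assumes "dependent n H C"
  shows "3 \<le> card C"
proof (rule ccontr)
  assume "\<not> ?thesis"
  moreover have C: "C \<subseteq> {1..n}" "codim (\<Inter>i\<in>C. H i) < card C"
    using assms by (auto simp: dependent_def)
  \<comment> \<open>\<open>card C = 0\<close> is impossible, since no codimension is below
    0.\<close>
  ultimately consider "card C = 1" | "card C = 2" by linarith
  then show False
  proof cases
    case 1
    then obtain i where "C = {i}" by (auto simp: card_1_singleton_iff)
    with C arrangement_hyperplane[of i] show False by (auto simp: hyperplane_def)
  next
    case 2
    then obtain i j where "C = {i, j}" "i \<noteq> j" by (auto simp: card_2_iff)
    with C arrangement_dim_Int[of i j] show False by (auto simp: codim_def)
  qed
qed

text \<open>Proper subsets are too small to be dependent, so only the codimension of the triple
  intersection matters. It is below three exactly when the third hyperplane does not cut down the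
  codimension-two intersection of the first two.\<close>

lemma circuit_triple_iff:
  assumes ij: "i \<in> {1..n}" "j \<in> {1..n}" "k \<in> {1..n}" and ne: "i \<noteq> j" "j \<noteq> k" "i \<noteq> k"
  shows "circuit n H {i, j, k} \<longleftrightarrow> H i \<inter> H j \<subseteq> H k"
proof -
  have card: "card {i, j, k} = 3" using ne by auto
  have "\<not> dependent n H D" if "D \<subset> {i, j, k}" for D
    using psubset_card_mono[OF _ that] card card_dependent_ge[of D] by force
  then have "circuit n H {i, j, k} \<longleftrightarrow> dependent n H {i, j, k}"
    by (auto simp: circuit_def)
  also have "\<dots> \<longleftrightarrow> codim (H i \<inter> H j \<inter> H k) < 3"
    using ij card by (auto simp: dependent_def Int_assoc)
  also have "\<dots> \<longleftrightarrow> vec.dim (H i \<inter> H j) \<le> vec.dim (H i \<inter> H j \<inter> H k)"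
    using arrangement_dim_Int[OF ij(1,2) ne(1)] by (auto simp: codim_def)
  also have "\<dots> \<longleftrightarrow> H i \<inter> H j \<subseteq> H k"
  proof
    assume le: "vec.dim (H i \<inter> H j) \<le> vec.dim (H i \<inter> H j \<inter> H k)"
    have "vec.subspace (H i \<inter> H j \<inter> H k)"
      using ij arrangement_hyperplane by (auto simp: hyperplane_def intro!: vec.subspace_inter)
    then have "H i \<inter> H j \<inter> H k = H i \<inter> H j"
      using le ij by (intro vec.subspace_dim_equal arrangement_subspace_Int) auto
    then show "H i \<inter> H j \<subseteq> H k" by blast
  next
    assume "H i \<inter> H j \<subseteq> H k"
    then have "H i \<inter> H j \<inter> H k = H i \<inter> H j" by blast
    then show "vec.dim (H i \<inter> H j) \<le> vec.dim (H i \<inter> H j \<inter> H k)" by simp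
  qed
  finally show ?thesis .
qed

lemma circuit_triple_of_line:
  assumes X: "X \<in> lines n H" and "i \<in> X" "j \<in> X" "k \<in> X" "i \<noteq> j" "j \<noteq> k" "i \<noteq> k"
  shows "circuit n H {i, j, k}"
proof -
  have "H i \<inter> H j \<subseteq> H k"
    using line_eq[OF X \<open>i \<in> X\<close> \<open>j \<in> X\<close> \<open>i \<noteq> j\<close>] \<open>k \<in> X\<close> by blast
  moreover have "i \<in> {1..n}" "j \<in> {1..n}" "k \<in> {1..n}"
    using assms lines_subset[OF X] by blast+
  ultimately show ?thesis using assms by (simp add: circuit_triple_iff)
qed

text \<open>A circuit of three elements thus lies on a line or meets it in at most one index; this
  becomes the hypothesis \<open>flat\<close> of
  \<open>ext_boundary_triple_in_contract_kernel\<close>.\<close>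

lemma circuit_triple_in_line:
  assumes X: "X \<in> lines n H" and C: "circuit n H {i, j, k}" and ne: "i \<noteq> j" "j \<noteq> k" "i \<noteq> k"
    and "i \<in> X" "j \<in> X"
  shows "k \<in> X"
proof -
  have ijk: "{i, j, k} \<subseteq> {1..n}" using C by (auto simp: circuit_def dependent_def)
  then have "H i \<inter> H j \<subseteq> H k"
    using C ne circuit_triple_iff[of i j k] by simp
  then show ?thesis
    using line_eq[OF X \<open>i \<in> X\<close> \<open>j \<in> X\<close> \<open>i \<noteq> j\<close>] ijk by blast
qed

end

lemma card_3_sorted:
  fixes C :: "nat set"
  assumes "card C = 3"
  obtains i j k where "C = {i, j, k}" "i < j" "j < k"
proof -
  obtain a b c where C: "C = {a, b, c}" "a \<noteq> b" "b \<noteq> c" "a \<noteq> c"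
    using assms by (auto simp: card_3_iff)
  then consider "a < b \<and> b < c" | "a < c \<and> c < b" | "b < a \<and> a < c" | "b < c \<and> c < a"
    | "c < a \<and> a < b" | "c < b \<and> b < a" by linarith
  then show ?thesis
  proof cases
    case 1 then show ?thesis using that[of a b c] C by auto
  next
    case 2 then show ?thesis using that[of a c b] C by auto
  next
    case 3 then show ?thesis using that[of b a c] C by auto
  next
    case 4 then show ?thesis using that[of b c a] C by auto
  next
    case 5 then show ?thesis using that[of c a b] C by auto
  next
    case 6 then show ?thesis using that[of c b a] C by auto
  qed
qed


section \<open>The exterior algebra in low degrees\<close>

context cring
begin

text \<open>The degree-two coefficients as an alternating matrix, so that sums over a line need no
  case split on the order of indices. The diagonal is set to zero explicitly, because
  \<open>f {i, i}\<close> would be a degree-one coefficient.\<close>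

definition ext_form :: "(nat set \<Rightarrow> 'a) \<Rightarrow> nat \<Rightarrow> nat \<Rightarrow> 'a"
  where "ext_form f i j = (if i < j then f {i, j} else if j < i then \<ominus> f {i, j} else \<zero>)"

lemma ext_form_closed [simp]:
  "f \<in> carrier (ext_alg R n) \<Longrightarrow> i \<in> {1..n} \<Longrightarrow> j \<in> {1..n} \<Longrightarrow> ext_form f i j \<in> carrier R"
  using ext_coeff_closed[of f n "{i, j}"] unfolding ext_form_def by auto

lemma ext_form_add:
  assumes "f \<in> carrier (ext_alg R n)" "g \<in> carrier (ext_alg R n)" "i \<in> {1..n}" "j \<in> {1..n}"
  shows "ext_form (f \<oplus>\<^bsub>ext_alg R n\<^esub> g) i j = ext_form f i j \<oplus> ext_form g i j"
proof -
  have "{i, j} \<subseteq> {1..n}" using assms by auto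
  then show ?thesis
    using assms(1,2)[THEN ext_coeff_closed, of "{i, j}"] 
    by (auto simp: ext_form_def ext_add_apply minus_add)
qed

lemma ext_mult_apply_empty:
  assumes "f \<in> carrier (ext_alg R n)" "g \<in> carrier (ext_alg R n)"
  shows "(f \<otimes>\<^bsub>ext_alg R n\<^esub> g) {} = f {} \<otimes> g {}"
  using assms[THEN ext_coeff_closed, of "{}"]
  by (subst ext_mult_apply) auto

lemma ext_mult_apply_singleton:
  assumes "f \<in> carrier (ext_alg R n)" "g \<in> carrier (ext_alg R n)" "i \<in> {1..n}"
  shows "(f \<otimes>\<^bsub>ext_alg R n\<^esub> g) {i} = f {} \<otimes> g {i} \<oplus> f {i} \<otimes> g {}"
proof -
  have "Pow {i} = {{}, {i}}" by auto
  then show ?thesis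
  using assms(3) assms(1,2)[THEN ext_coeff_closed, of "{}"]
    assms(1,2)[THEN ext_coeff_closed, of "{i}"]
  by (subst ext_mult_apply) auto
qed

text \<open>Of the four ways to split \<open>{i, j}\<close> into two factors, only the one with
  \<open>{j}\<close> first has an inversion, namely \<open>(j, i)\<close>; it carries the minus
  sign.\<close>

lemma ext_mult_apply_doubleton:
  assumes fg: "f \<in> carrier (ext_alg R n)" "g \<in> carrier (ext_alg R n)" "i \<in> {1..n}" "j \<in> {1..n}" "i < j"
  shows "(f \<otimes>\<^bsub>ext_alg R n\<^esub> g) {i, j} =
    f {} \<otimes> g {i, j} \<oplus> (f {i} \<otimes> g {j} \<ominus> f {j} \<otimes> g {i}) \<oplus> f {i, j} \<otimes> g {}"
proof -
  have P: "Pow {i, j} = {{}, {i}, {j}, {i, j}}" by auto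
  have D: "{i, j} - {i} = {j}" "{i, j} - {j} = {i}" using assms by auto
  have s: "{(s, t). s \<in> {i} \<and> t \<in> {j} \<and> t < s} = {}" "{(s, t). s \<in> {j} \<and> t \<in> {i} \<and> t < s} = {(j, i)}"
    using assms by auto
  have inv: "inversions {i} {j} = 0" "inversions {j} {i} = 1"
    unfolding inversions_def s by auto
  have n1: "neg_one_pow R (Suc 0) = \<ominus> \<one>" by (simp add: neg_one_pow_def)
  have cl: "f S \<in> carrier R" "g S \<in> carrier R" if "S \<subseteq> {i, j}" for S
    using that fg by (auto intro!: ext_coeff_closed)
  have cl: "f {} \<in> carrier R" "g {} \<in> carrier R" "f {i} \<in> carrier R" "g {i} \<in> carrier R"
    "f {j} \<in> carrier R" "g {j} \<in> carrier R" "f {i, j} \<in> carrier R" "g {i, j} \<in> carrier R"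
    by (auto intro!: cl)
  have ne: "{} \<noteq> {i}" "{} \<noteq> {j}" "{i} \<noteq> {j}" "{i} \<noteq> {i, j}" "{j} \<noteq> {i, j}" using assms by auto
  have "(f \<otimes>\<^bsub>ext_alg R n\<^esub> g) {i, j} = f {} \<otimes> g {i, j} \<oplus> (f {i} \<otimes> g {j} \<oplus> (\<ominus> \<one> \<otimes> (f {j} \<otimes> g {i}) \<oplus> f {i, j} \<otimes> g {}))"
    using assms ne cl unfolding P
    by (subst ext_mult_apply) (auto simp: P D inv n1)
  then show ?thesis
    using cl by (simp add: minus_eq l_minus a_assoc)
qed

text \<open>Both sides change sign when \<open>i\<close> and \<open>j\<close> are exchanged and
  vanish for \<open>i = j\<close>, so the increasing case decides.\<close>

lemma ext_form_mult:
  assumes fg: "f \<in> carrier (ext_alg R n)" "g \<in> carrier (ext_alg R n)" "i \<in> {1..n}" "j \<in> {1..n}"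
  shows "ext_form (f \<otimes>\<^bsub>ext_alg R n\<^esub> g) i j =
    f {} \<otimes> ext_form g i j \<oplus> (f {i} \<otimes> g {j} \<ominus> f {j} \<otimes> g {i}) \<oplus> ext_form f i j \<otimes> g {}"
proof -
  have cl: "f S \<in> carrier R" "g S \<in> carrier R" if "S \<subseteq> {i, j}" for S
    using that fg by (auto intro!: ext_coeff_closed)
  have cl: "f {} \<in> carrier R" "g {} \<in> carrier R" "f {i} \<in> carrier R" "g {i} \<in> carrier R"
    "f {j} \<in> carrier R" "g {j} \<in> carrier R" "f {i, j} \<in> carrier R" "g {i, j} \<in> carrier R"
    by (auto intro!: cl)
  consider "i < j" | "j < i" | "i = j" by linarith
  then show ?thesis
  proof cases
    case 1
    then show ?thesis
      unfolding ext_form_def using ext_mult_apply_doubleton[OF fg] by simp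
  next
    case 2
    have "{j, i} = {i, j}" by auto
    then show ?thesis
      unfolding ext_form_def using ext_mult_apply_doubleton[OF fg(1,2,4,3) 2] 2 cl
      by (simp add: minus_eq minus_add r_minus l_minus a_ac)
  next
    case 3
    then show ?thesis
      using cl by (simp add: ext_form_def minus_eq r_neg)
  qed
qed

lemma ext_gen_carrier [simp]: "ext_gen R n i \<in> carrier (ext_alg R n)"
  by (simp add: ext_gen_def ext_monom_carrier)

lemma ext_monom_apply: "S \<subseteq> {1..n} \<Longrightarrow> ext_monom R n T S = (if S = T then \<one> else \<zero>)"
  by (simp add: ext_monom_def)

lemma ext_monom_doubleton:
  assumes "i \<in> {1..n}" "j \<in> {1..n}" "i < j"
  shows "ext_monom R n {i, j} = ext_gen R n i \<otimes>\<^bsub>ext_alg R n\<^esub> ext_gen R n j"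
  using ext_monom_insert[of i "{j}" n] assms by (simp add: ext_gen_def)

text \<open>Anticommutation absorbs the sign of the middle term: minus e_i e_k is e_k e_i. The
  resulting cyclic form is the one used for the contractions and for the relation in the
  quotient.\<close>

lemma ext_boundary_triple:
  assumes "i \<in> {1..n}" "j \<in> {1..n}" "k \<in> {1..n}" "i < j" "j < k"
  shows "ext_boundary R n {i, j, k} =
    ext_gen R n i \<otimes>\<^bsub>ext_alg R n\<^esub> ext_gen R n j
    \<oplus>\<^bsub>ext_alg R n\<^esub> ext_gen R n j \<otimes>\<^bsub>ext_alg R n\<^esub> ext_gen R n k
    \<oplus>\<^bsub>ext_alg R n\<^esub> ext_gen R n k \<otimes>\<^bsub>ext_alg R n\<^esub> ext_gen R n i"
proof -
  interpret E: ring "ext_alg R n" by (rule ring_ext_alg)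
  have s: "{l \<in> {i, j, k}. l < i} = {}" "{l \<in> {i, j, k}. l < j} = {i}"
    "{l \<in> {i, j, k}. l < k} = {i, j}"
    "{i, j, k} - {i} = {j, k}" "{i, j, k} - {j} = {i, k}" "{i, j, k} - {k} = {i, j}"
    using assms by auto
  have c: "card {i} = 1" "card {i, j} = 2" using assms by auto
  have p: "neg_one_pow (ext_alg R n) 0 = \<one>\<^bsub>ext_alg R n\<^esub>"
    "neg_one_pow (ext_alg R n) 1 = \<ominus>\<^bsub>ext_alg R n\<^esub> \<one>\<^bsub>ext_alg R n\<^esub>"
    "neg_one_pow (ext_alg R n) 2 = \<one>\<^bsub>ext_alg R n\<^esub>"
    by (simp_all add: neg_one_pow_def numeral_2_eq_2 E.l_minus E.r_minus)
  have k: "\<ominus>\<^bsub>ext_alg R n\<^esub> (ext_gen R n i \<otimes>\<^bsub>ext_alg R n\<^esub> ext_gen R n k) =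
    ext_gen R n k \<otimes>\<^bsub>ext_alg R n\<^esub> ext_gen R n i"
    using ext_gen_anticomm[of k n i] assms by (intro E.minus_equality) auto
  define g where "g l = neg_one_pow (ext_alg R n) (card {m \<in> {i, j, k}. m < l})
    \<otimes>\<^bsub>ext_alg R n\<^esub> ext_monom R n ({i, j, k} - {l})" for l
  have "g i = ext_gen R n j \<otimes>\<^bsub>ext_alg R n\<^esub> ext_gen R n k"
    unfolding g_def s card.empty p using assms by (simp add: ext_monom_doubleton)
  moreover have "g j = ext_gen R n k \<otimes>\<^bsub>ext_alg R n\<^esub> ext_gen R n i"
    unfolding g_def s c p using assms by (simp add: ext_monom_doubleton E.l_minus k)
  moreover have "g k = ext_gen R n i \<otimes>\<^bsub>ext_alg R n\<^esub> ext_gen R n j"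
    unfolding g_def s c p using assms by (simp add: ext_monom_doubleton)
  moreover have "ext_boundary R n {i, j, k} = finsum (ext_alg R n) g {i, j, k}"
    unfolding ext_boundary_def g_def ..
  ultimately show ?thesis using assms by (simp add: E.a_ac)
qed

lemma ext_finsum_apply:
  assumes "finite A" "F \<in> A \<rightarrow> carrier (ext_alg R n)" "S \<subseteq> {1..n}"
  shows "(\<Oplus>\<^bsub>ext_alg R n\<^esub>i\<in>A. F i) S = (\<Oplus>i\<in>A. F i S)"
proof -
  interpret E: ring "ext_alg R n" by (rule ring_ext_alg)
  show ?thesis
    using assms(1,2)
  proof (induction A rule: finite_induct)
    case empty
    have "\<zero>\<^bsub>ext_alg R n\<^esub> S = \<zero>" using assms(3) by (auto simp: ext_alg_def)
    then show ?case by simp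
  next
    case (insert x A)
    then have "F i S \<in> carrier R" if "i \<in> insert x A" for i
      using that by (auto intro!: ext_coeff_closed[OF _ assms(3)])
    with insert show ?case
      by (auto simp: ext_add_apply[OF assms(3)] Pi_iff)
  qed
qed

section \<open>Scalars and linear forms in the exterior algebra\<close>

lemma ext_scalar_carrier [simp]: "r \<in> carrier R \<Longrightarrow> ext_scalar R n r \<in> carrier (ext_alg R n)"
  by (auto simp: ext_alg_def ext_scalar_def)

lemma ext_scalar_apply: "S \<subseteq> {1..n} \<Longrightarrow> ext_scalar R n r S = (if S = {} then r else \<zero>)"
  by (simp add: ext_scalar_def)

lemma ext_scalar_mult_apply:
  assumes r: "r \<in> carrier R" and f: "f \<in> carrier (ext_alg R n)" and S: "S \<subseteq> {1..n}"
  shows "(ext_scalar R n r \<otimes>\<^bsub>ext_alg R n\<^esub> f) S = r \<otimes> f S"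
    and "(f \<otimes>\<^bsub>ext_alg R n\<^esub> ext_scalar R n r) S = r \<otimes> f S"
proof -
  have fin: "finite S" using S by (rule finite_subset) simp
  have c: "f T \<in> carrier R" if "T \<subseteq> S" for T using ext_coeff_closed[OF f] S that by blast
  have c': "f (S - T) \<in> carrier R" for T by (rule c) auto
  have o: "ext_scalar R n r T = (if T = {} then r else \<zero>)" if "T \<subseteq> S" for T
    using that S by (intro ext_scalar_apply) blast
  have o': "ext_scalar R n r (S - T) = (if S \<subseteq> T then r else \<zero>)" for T
    by (subst o) auto
  show "(ext_scalar R n r \<otimes>\<^bsub>ext_alg R n\<^esub> f) S = r \<otimes> f S"
    unfolding ext_mult_apply[OF S]
    by (subst finsum_single[where a = "{}"]) (use fin r c c' o in auto)
  show "(f \<otimes>\<^bsub>ext_alg R n\<^esub> ext_scalar R n r) S = r \<otimes> f S"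
    unfolding ext_mult_apply[OF S]
    by (subst finsum_single[where a = S]) (use fin r c[of S] c o' o'[of S] in \<open>auto simp: m_comm\<close>)
qed

lemma ext_scalar_commute:
  assumes "r \<in> carrier R" "f \<in> carrier (ext_alg R n)"
  shows "f \<otimes>\<^bsub>ext_alg R n\<^esub> ext_scalar R n r = ext_scalar R n r \<otimes>\<^bsub>ext_alg R n\<^esub> f"
  by (rule ext_eqI[where n = n]) (simp_all add: assms ext_mult_carrier ext_scalar_mult_apply)

lemma ext_scalar_ring_hom: "ring_hom_ring R (ext_alg R n) (ext_scalar R n)"
proof (rule ring_hom_ringI)
  show "ring R" by (rule ring_axioms)
  fix x y assume xy: "x \<in> carrier R" "y \<in> carrier R"
  show "ext_scalar R n (x \<otimes> y) = ext_scalar R n x \<otimes>\<^bsub>ext_alg R n\<^esub> ext_scalar R n y"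
    by (rule ext_eqI[where n = n])
      (use xy in \<open>auto simp: ext_mult_carrier ext_scalar_mult_apply ext_scalar_apply m_comm\<close>)
  show "ext_scalar R n (x \<oplus> y) = ext_scalar R n x \<oplus>\<^bsub>ext_alg R n\<^esub> ext_scalar R n y"
    by (rule ext_eqI[where n = n])
      (use xy in \<open>auto simp: ext_add_carrier ext_add_apply ext_scalar_apply\<close>)
qed (use ring_ext_alg in \<open>auto simp: ext_scalar_def ext_alg_def m_comm\<close>)

text \<open>The lift of \<open>os_vec\<close> to the exterior algebra (see
  \<open>os_vec_eq_proj\<close>), where coefficients can be read off.\<close>

definition ext_vec :: "nat \<Rightarrow> (nat \<Rightarrow> 'a) \<Rightarrow> nat set \<Rightarrow> 'a"
  where "ext_vec n v =
    (\<Oplus>\<^bsub>ext_alg R n\<^esub>i\<in>{1..n}. ext_scalar R n (v i) \<otimes>\<^bsub>ext_alg R n\<^esub> ext_gen R n i)"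

lemma ext_vec_carrier:
  assumes "v \<in> {1..n} \<rightarrow> carrier R"
  shows "ext_vec n v \<in> carrier (ext_alg R n)"
proof -
  interpret E: ring "ext_alg R n" by (rule ring_ext_alg)
  show ?thesis unfolding ext_vec_def using assms by (intro E.finsum_closed) (auto simp: Pi_iff)
qed

lemma ext_vec_apply:
  assumes v: "v \<in> {1..n} \<rightarrow> carrier R" and S: "S \<subseteq> {1..n}"
  shows "ext_vec n v S = (\<Oplus>i\<in>{1..n}. v i \<otimes> (if S = {i} then \<one> else \<zero>))"
proof -
  have "ext_vec n v S = (\<Oplus>i\<in>{1..n}. (ext_scalar R n (v i) \<otimes>\<^bsub>ext_alg R n\<^esub> ext_gen R n i) S)"
    unfolding ext_vec_def using v S
    by (intro ext_finsum_apply) (auto simp: Pi_iff intro!: ext_mult_carrier)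
  also have "\<dots> = (\<Oplus>i\<in>{1..n}. v i \<otimes> (if S = {i} then \<one> else \<zero>))"
    by (rule finsum_cong')
      (use v S in \<open>auto simp: ext_scalar_mult_apply ext_gen_def ext_monom_apply Pi_iff
        ext_monom_carrier\<close>)
  finally show ?thesis .
qed

lemma ext_vec_empty: "v \<in> {1..n} \<rightarrow> carrier R \<Longrightarrow> ext_vec n v {} = \<zero>"
  by (subst ext_vec_apply) (auto simp: Pi_iff intro!: add.finprod_one_eqI)

lemma ext_vec_singleton:
  "v \<in> {1..n} \<rightarrow> carrier R \<Longrightarrow> i \<in> {1..n} \<Longrightarrow> ext_vec n v {i} = v i"
  by (subst ext_vec_apply, simp, simp, subst finsum_single[where a = i]) (auto simp: Pi_iff)

end


section \<open>The degree-two part of the Orlik--Solomon ideal\<close>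

context cring
begin

text \<open>Up to sign, the coefficient at \<open>e\<^sub>i\<close> of the boundary of the part of \<open>f\<close> spanned by the
  \<open>e\<^sub>p e\<^sub>q\<close> with \<open>p, q \<in> X\<close>.\<close>

definition ext_contract :: "nat set \<Rightarrow> nat \<Rightarrow> (nat set \<Rightarrow> 'a) \<Rightarrow> 'a"
  where "ext_contract X i f = (\<Oplus>j\<in>X. ext_form f i j)"

lemma ext_contract_closed [simp]:
  "f \<in> carrier (ext_alg R n) \<Longrightarrow> X \<subseteq> {1..n} \<Longrightarrow> i \<in> X \<Longrightarrow> ext_contract X i f \<in> carrier R"
  unfolding ext_contract_def by (rule finsum_closed) (auto intro!: ext_form_closed)

lemma ext_contract_add:
  assumes "f \<in> carrier (ext_alg R n)" "g \<in> carrier (ext_alg R n)" "X \<subseteq> {1..n}" "i \<in> X"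
  shows "ext_contract X i (f \<oplus>\<^bsub>ext_alg R n\<^esub> g) = ext_contract X i f \<oplus> ext_contract X i g"
proof -
  have *: "i \<in> {1..n}" "\<And>j. j \<in> X \<Longrightarrow> j \<in> {1..n}" using assms by auto
  have "ext_contract X i (f \<oplus>\<^bsub>ext_alg R n\<^esub> g) = (\<Oplus>j\<in>X. ext_form f i j \<oplus> ext_form g i j)"
    unfolding ext_contract_def using assms *
    by (intro finsum_cong' refl funcsetI ext_form_add a_closed ext_form_closed[of _ n])
  also have "\<dots> = ext_contract X i f \<oplus> ext_contract X i g"
    unfolding ext_contract_def using assms *
    by (intro finsum_addf funcsetI ext_form_closed[of _ n])
  finally show ?thesis .
qed

text \<open>This is \<open>ext_form_mult\<close> summed over \<open>j\<close>. For factors without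
  constant term only the middle bracket survives, and for linear forms its vanishing is the equation
  on the line.\<close>

lemma ext_contract_mult:
  assumes fg: "f \<in> carrier (ext_alg R n)" "g \<in> carrier (ext_alg R n)" and X: "X \<subseteq> {1..n}" "i \<in> X"
  shows "ext_contract X i (f \<otimes>\<^bsub>ext_alg R n\<^esub> g) =
    f {} \<otimes> ext_contract X i g \<oplus> (f {i} \<otimes> (\<Oplus>j\<in>X. g {j}) \<ominus> (\<Oplus>j\<in>X. f {j}) \<otimes> g {i})
    \<oplus> ext_contract X i f \<otimes> g {}"
proof -
  have *: "i \<in> {1..n}" "\<And>j. j \<in> X \<Longrightarrow> j \<in> {1..n}" using X by auto
  have fin: "finite X" using X(1) by (rule finite_subset) simp
  have cl [simp]: "f {} \<in> carrier R" "g {} \<in> carrier R" "f {j} \<in> carrier R" "g {j} \<in> carrier R"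
    "ext_form f i j \<in> carrier R" "ext_form g i j \<in> carrier R" if "j \<in> X" for j
    using fg * that by (auto intro!: ext_coeff_closed[of _ n] ext_form_closed[of _ n])
  note [simp] = cl[OF X(2)]
  \<comment> \<open>The subtraction is written as a product with \<open>\<ominus> g {i}\<close>, so
    that each sum factors by distributivity.\<close>
  have "ext_contract X i (f \<otimes>\<^bsub>ext_alg R n\<^esub> g) =
      (\<Oplus>j\<in>X. f {} \<otimes> ext_form g i j \<oplus> (f {i} \<otimes> g {j} \<oplus> f {j} \<otimes> (\<ominus> g {i})) \<oplus> ext_form f i j \<otimes> g {})"
    unfolding ext_contract_def
  proof (rule finsum_cong'[OF refl])
    fix j assume j: "j \<in> X"
    then show "ext_form (f \<otimes>\<^bsub>ext_alg R n\<^esub> g) i j =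
      f {} \<otimes> ext_form g i j \<oplus> (f {i} \<otimes> g {j} \<oplus> f {j} \<otimes> (\<ominus> g {i})) \<oplus> ext_form f i j \<otimes> g {}"
      by (subst ext_form_mult[OF fg]) (use * in \<open>simp_all add: minus_eq r_minus\<close>)
  qed auto
  also have "\<dots> = (\<Oplus>j\<in>X. f {} \<otimes> ext_form g i j)
      \<oplus> ((\<Oplus>j\<in>X. f {i} \<otimes> g {j}) \<oplus> (\<Oplus>j\<in>X. f {j} \<otimes> (\<ominus> g {i})))
      \<oplus> (\<Oplus>j\<in>X. ext_form f i j \<otimes> g {})"
    by (simp add: finsum_addf Pi_iff)
  also have "(\<Oplus>j\<in>X. f {} \<otimes> ext_form g i j) = f {} \<otimes> ext_contract X i g"
    unfolding ext_contract_def using fin by (intro finsum_rdistr[symmetric]) auto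
  also have "(\<Oplus>j\<in>X. ext_form f i j \<otimes> g {}) = ext_contract X i f \<otimes> g {}"
    unfolding ext_contract_def using fin by (intro finsum_ldistr[symmetric]) auto
  also have "(\<Oplus>j\<in>X. f {i} \<otimes> g {j}) = f {i} \<otimes> (\<Oplus>j\<in>X. g {j})"
    using fin by (intro finsum_rdistr[symmetric]) auto
  also have "(\<Oplus>j\<in>X. f {j} \<otimes> (\<ominus> g {i})) = (\<Oplus>j\<in>X. f {j}) \<otimes> (\<ominus> g {i})"
    using fin by (intro finsum_ldistr[symmetric]) auto
  finally show ?thesis by (simp add: minus_eq r_minus finsum_closed Pi_iff)
qed

text \<open>The ideal that is to contain the Orlik-Solomon ideal. The conditions in degrees 0 and 1
  make it closed under multiplication; degrees above two are unrestricted.\<close>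

definition contract_kernel :: "nat \<Rightarrow> nat set set \<Rightarrow> (nat set \<Rightarrow> 'a) set"
  where "contract_kernel n L = {f \<in> carrier (ext_alg R n). f {} = \<zero> \<and> (\<forall>i\<in>{1..n}. f {i} = \<zero>) \<and>
    (\<forall>X\<in>L. \<forall>i\<in>X. ext_contract X i f = \<zero>)}"

text \<open>As \<open>f\<close> vanishes in degrees 0 and 1, only the constant term of
  \<open>g\<close> reaches degree two of the product: each contraction is multiplied by
  \<open>g {}\<close>. Both sides are treated since the exterior algebra is not commutative.\<close>

lemma contract_kernel_mult:
  assumes f: "f \<in> contract_kernel n L" and g: "g \<in> carrier (ext_alg R n)" and L: "\<And>X. X \<in> L \<Longrightarrow> X \<subseteq> {1..n}"
  shows "g \<otimes>\<^bsub>ext_alg R n\<^esub> f \<in> contract_kernel n L" "f \<otimes>\<^bsub>ext_alg R n\<^esub> g \<in> contract_kernel n L"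
proof -
  have fc: "f \<in> carrier (ext_alg R n)" and f0: "f {} = \<zero>" "\<And>i. i \<in> {1..n} \<Longrightarrow> f {i} = \<zero>"
    and fX: "\<And>X i. X \<in> L \<Longrightarrow> i \<in> X \<Longrightarrow> ext_contract X i f = \<zero>"
    using f by (auto simp: contract_kernel_def)
  have g0: "g {} \<in> carrier R" "\<And>i. i \<in> {1..n} \<Longrightarrow> g {i} \<in> carrier R"
    using g by (auto intro!: ext_coeff_closed[of _ n])
  have X: "finite X" "i \<in> {1..n}" "(\<Oplus>j\<in>X. f {j}) = \<zero>" "(\<Oplus>j\<in>X. g {j}) \<in> carrier R"
    "ext_contract X i g \<in> carrier R"
    if "X \<in> L" "i \<in> X" for X i
  proof -
    have s: "X \<subseteq> {1..n}" using L that by auto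
    then show "finite X" "i \<in> {1..n}" using that by (auto intro: finite_subset)
    show "(\<Oplus>j\<in>X. f {j}) = \<zero>" using f0 s by (intro add.finprod_one_eqI) auto
    show "(\<Oplus>j\<in>X. g {j}) \<in> carrier R" using g0 s by (intro finsum_closed) auto
    show "ext_contract X i g \<in> carrier R" using g s that by simp
  qed
  show "g \<otimes>\<^bsub>ext_alg R n\<^esub> f \<in> contract_kernel n L"
    unfolding contract_kernel_def
    using f0 g0 X L
    by (auto simp: fX fc g ext_mult_carrier ext_mult_apply_empty ext_mult_apply_singleton
      ext_contract_mult[where n = n] minus_eq simp del: atLeastAtMost_iff)
  show "f \<otimes>\<^bsub>ext_alg R n\<^esub> g \<in> contract_kernel n L"
    unfolding contract_kernel_def
    using f0 g0 X L
    by (auto simp: fX fc g ext_mult_carrier ext_mult_apply_empty ext_mult_apply_singleton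
      ext_contract_mult[where n = n] minus_eq simp del: atLeastAtMost_iff)
qed

lemma contract_kernel_add:
  assumes "f \<in> contract_kernel n L" "g \<in> contract_kernel n L" "\<And>X. X \<in> L \<Longrightarrow> X \<subseteq> {1..n}"
  shows "f \<oplus>\<^bsub>ext_alg R n\<^esub> g \<in> contract_kernel n L"
  using assms
  by (auto simp: contract_kernel_def ext_add_carrier ext_add_apply ext_contract_add[where n = n])

lemma ideal_contract_kernel:
  assumes L: "\<And>X. X \<in> L \<Longrightarrow> X \<subseteq> {1..n}"
  shows "ideal (contract_kernel n L) (ext_alg R n)"
proof -
  interpret E: ring "ext_alg R n" by (rule ring_ext_alg)
  have z: "\<zero>\<^bsub>ext_alg R n\<^esub> \<in> contract_kernel n L"
  proof -
    have "\<zero>\<^bsub>ext_alg R n\<^esub> S = \<zero>" if "S \<subseteq> {1..n}" for S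
      using that by (simp add: ext_alg_def)
    then have "ext_contract X i \<zero>\<^bsub>ext_alg R n\<^esub> = \<zero>" if "X \<in> L" "i \<in> X" for X i
      using L[OF that(1)] that unfolding ext_contract_def
      by (intro add.finprod_one_eqI) (auto simp: ext_form_def subset_iff)
    then show ?thesis
      by (auto simp: contract_kernel_def ext_alg_def)
  qed
  show ?thesis
  proof (rule idealI[OF ring_ext_alg])
    show "subgroup (contract_kernel n L) (add_monoid (ext_alg R n))"
    proof (rule E.add.subgroupI)
      fix f assume f: "f \<in> contract_kernel n L"
      then have "f \<in> carrier (ext_alg R n)" by (simp add: contract_kernel_def)
      \<comment> \<open>Closure under negation is reduced to closure under multiplication, by minus
        one.\<close>
      then have "\<ominus>\<^bsub>ext_alg R n\<^esub> f = (\<ominus>\<^bsub>ext_alg R n\<^esub> \<one>\<^bsub>ext_alg R n\<^esub>) \<otimes>\<^bsub>ext_alg R n\<^esub> f"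
        by (simp add: E.l_minus)
      then show "\<ominus>\<^bsub>ext_alg R n\<^esub> f \<in> contract_kernel n L"
        using contract_kernel_mult(1)[OF f _ L, of "\<ominus>\<^bsub>ext_alg R n\<^esub> \<one>\<^bsub>ext_alg R n\<^esub>"] by simp
    next
      show "contract_kernel n L \<subseteq> carrier (ext_alg R n)" by (auto simp: contract_kernel_def)
      show "contract_kernel n L \<noteq> {}" using z by auto
    qed (use contract_kernel_add[OF _ _ L] in auto)
  qed (use contract_kernel_mult[OF _ _ L] in auto)
qed

text \<open>The coefficient at e_i of e_a - e_b, the negative of the boundary of e_a e_b, if
  \<open>a\<close> and \<open>b\<close> both lie in \<open>X\<close>; zero otherwise.\<close>

lemma ext_contract_gen_mult:
  assumes "a \<in> {1..n}" "b \<in> {1..n}" and X: "X \<subseteq> {1..n}" "i \<in> X"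
  shows "ext_contract X i (ext_gen R n a \<otimes>\<^bsub>ext_alg R n\<^esub> ext_gen R n b) =
    (if a = i \<and> b \<in> X then \<one> else \<zero>) \<ominus> (if a \<in> X \<and> b = i then \<one> else \<zero>)"
proof -
  have fin: "finite X" using X(1) by (rule finite_subset) simp
  have g: "ext_gen R n a {} = \<zero>" "j \<in> X \<Longrightarrow> ext_gen R n a {j} = (if a = j then \<one> else \<zero>)" for a j
    using X by (auto simp: ext_gen_def ext_monom_def)
  have s: "(\<Oplus>j\<in>X. ext_gen R n a {j}) = (if a \<in> X then \<one> else \<zero>)" for a
  proof (cases "a \<in> X")
    case True
    then show ?thesis using g fin by (subst finsum_single[where a = a]) auto
  next
    case False
    then show ?thesis using g by (auto intro!: add.finprod_one_eqI)
  qed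
  show ?thesis
    using assms ext_contract_closed[OF ext_gen_carrier X]
    by (subst ext_contract_mult[where n = n]) (auto simp: g s minus_eq)
qed

lemma ext_gen_mult_low_degree:
  assumes "a \<in> {1..n}" "b \<in> {1..n}"
  shows "(ext_gen R n a \<otimes>\<^bsub>ext_alg R n\<^esub> ext_gen R n b) {} = \<zero>"
    "i \<in> {1..n} \<Longrightarrow> (ext_gen R n a \<otimes>\<^bsub>ext_alg R n\<^esub> ext_gen R n b) {i} = \<zero>"
proof -
  have g: "ext_gen R n a {} = \<zero>" "i \<in> {1..n} \<Longrightarrow> ext_gen R n a {i} \<in> carrier R" for a i
    by (auto simp: ext_gen_def ext_monom_def)
  show "(ext_gen R n a \<otimes>\<^bsub>ext_alg R n\<^esub> ext_gen R n b) {} = \<zero>"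
    by (simp add: ext_mult_apply_empty g)
  show "(ext_gen R n a \<otimes>\<^bsub>ext_alg R n\<^esub> ext_gen R n b) {i} = \<zero>" if "i \<in> {1..n}"
    using that by (simp add: ext_mult_apply_singleton g del: atLeastAtMost_iff)
qed

text \<open>If the whole triple lies in \<open>X\<close>, the three differences cancel cyclically,
  as the boundary of a boundary. Otherwise \<open>flat\<close> leaves at most one index in
  \<open>X\<close>, and every term contracts to zero.\<close>

lemma ext_boundary_triple_in_contract_kernel:
  assumes ijk: "i \<in> {1..n}" "j \<in> {1..n}" "k \<in> {1..n}" "i < j" "j < k"
    and L: "\<And>X. X \<in> L \<Longrightarrow> X \<subseteq> {1..n}"
    and flat: "\<And>X p q. X \<in> L \<Longrightarrow> p \<in> {i, j, k} \<inter> X \<Longrightarrow> q \<in> {i, j, k} \<inter> X \<Longrightarrow> p \<noteq> q \<Longrightarrow> {i, j, k} \<subseteq> X"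
  shows "ext_boundary R n {i, j, k} \<in> contract_kernel n L"
proof -
  interpret E: ring "ext_alg R n" by (rule ring_ext_alg)
  have "ext_contract X p (ext_boundary R n {i, j, k}) = \<zero>" if X: "X \<in> L" "p \<in> X" for X p
  proof -
    have cases: "(i \<in> X \<and> j \<in> X \<and> k \<in> X) \<or> (i \<notin> X \<and> j \<notin> X) \<or> (i \<notin> X \<and> k \<notin> X) \<or> (j \<notin> X \<and> k \<notin> X)"
      using flat[OF X(1), of i j] flat[OF X(1), of i k] flat[OF X(1), of j k] ijk by auto
    have "ext_contract X p (ext_boundary R n {i, j, k}) =
        ((if i = p \<and> j \<in> X then \<one> else \<zero>) \<ominus> (if i \<in> X \<and> j = p then \<one> else \<zero>)) \<oplus>
        ((if j = p \<and> k \<in> X then \<one> else \<zero>) \<ominus> (if j \<in> X \<and> k = p then \<one> else \<zero>)) \<oplus>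
        ((if k = p \<and> i \<in> X then \<one> else \<zero>) \<ominus> (if k \<in> X \<and> i = p then \<one> else \<zero>))"
      unfolding ext_boundary_triple[OF ijk]
      using X L ijk by (simp add: ext_contract_add[where n = n] ext_contract_gen_mult)
    also have "\<dots> = \<zero>"
      using cases X ijk by (auto simp: minus_eq r_neg l_neg)
    finally show ?thesis .
  qed
  then show ?thesis
    using ijk(1-3) unfolding contract_kernel_def ext_boundary_triple[OF ijk]
    by (auto simp: ext_add_apply ext_gen_mult_low_degree)
qed

text \<open>The boundary of \<open>C\<close> involves only monomials on at least three indices,
  while the kernel conditions concern degrees up to two.\<close>

lemma ext_boundary_large_in_contract_kernel:
  assumes C: "C \<subseteq> {1..n}" "4 \<le> card C" and L: "\<And>X. X \<in> L \<Longrightarrow> X \<subseteq> {1..n}"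
  shows "ext_boundary R n C \<in> contract_kernel n L"
proof -
  interpret E: ring "ext_alg R n" by (rule ring_ext_alg)
  interpret K: ideal "contract_kernel n L" "ext_alg R n" using L by (rule ideal_contract_kernel)
  have fin: "finite C" using C(1) by (rule finite_subset) simp
  have "ext_monom R n (C - {i}) \<in> contract_kernel n L" if i: "i \<in> C" for i
  proof -
    have "3 \<le> card (C - {i})" using C fin i by (simp add: card_Diff_singleton)
    then have z: "ext_monom R n (C - {i}) S = \<zero>" if "S \<subseteq> {1..n}" "card S \<le> 2" for S
      using that by (auto simp: ext_monom_def)
    have "ext_contract X p (ext_monom R n (C - {i})) = \<zero>" if "X \<in> L" "p \<in> X" for X p
    proof -
      have "ext_monom R n (C - {i}) {p, q} = \<zero>" if "q \<in> X" for q
        using L[OF \<open>X \<in> L\<close>] \<open>p \<in> X\<close> that by (intro z) (auto simp: card_insert_if)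
      then show ?thesis
        unfolding ext_contract_def by (intro add.finprod_one_eqI) (auto simp: ext_form_def)
    qed
    then show ?thesis
      unfolding contract_kernel_def using z by (auto simp: ext_monom_carrier)
  qed
  then show ?thesis
    unfolding ext_boundary_def neg_one_pow_def
    by (intro K.finsum_mem fin funcsetI K.I_l_closed E.nat_pow_closed) auto
qed

text \<open>By minimality of the generated ideal only boundaries of circuits have to be checked:
  triples use the incidence of circuits and lines, larger circuits a degree count.\<close>

lemma os_ideal_subset_contract_kernel:
  assumes arr: "arrangement n H"
  shows "os_ideal R n H \<subseteq> contract_kernel n (lines n H)"
proof -
  interpret E: ring "ext_alg R n" by (rule ring_ext_alg)
  have L: "X \<subseteq> {1..n}" if "X \<in> lines n H" for X
    using lines_subset[OF arr that] .
  have "ext_boundary R n C \<in> contract_kernel n (lines n H)" if C: "circuit n H C" for C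
  proof -
    have sub: "C \<subseteq> {1..n}" "3 \<le> card C"
      using C card_dependent_ge[OF arr] by (auto simp: circuit_def dependent_def)
    show ?thesis
    proof (cases "card C = 3")
      case True
      then obtain i j k where ijk: "C = {i, j, k}" "i < j" "j < k" by (rule card_3_sorted)
      have in_line: "{i, j, k} \<subseteq> X"
        if "X \<in> lines n H" "p \<in> {i, j, k} \<inter> X" "q \<in> {i, j, k} \<inter> X" "p \<noteq> q" for X p q
      proof
        fix r assume r: "r \<in> {i, j, k}"
        show "r \<in> X"
        proof (cases "r = p \<or> r = q")
          case False
          then have "{p, q, r} = {i, j, k}"
            using that r ijk(2,3) by auto
          then have "circuit n H {p, q, r}" using C ijk(1) by simp
          then show ?thesis
            using circuit_triple_in_line[OF arr that(1), of p q r] that False by auto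
        qed (use that in auto)
      qed
      show ?thesis
        using ext_boundary_triple_in_contract_kernel[OF _ _ _ ijk(2,3) L in_line] sub(1) ijk(1) by auto
    next
      case False
      then show ?thesis
        using sub L by (intro ext_boundary_large_in_contract_kernel) auto
    qed
  qed
  then show ?thesis
    unfolding os_ideal_def using ideal_contract_kernel[OF L] by (intro E.genideal_minimal) auto
qed

end


section \<open>Products in the Orlik--Solomon algebra\<close>

context cring
begin

lemma os_proj_ring_hom: "ring_hom_ring (ext_alg R n) (os_alg R n H) (os_proj R n H)"
  using ideal.rcos_ring_hom_ring[OF ideal_os_ideal] by (simp add: os_alg_def os_proj_def[abs_def])

lemma os_proj_eq_zero_iff:
  assumes "f \<in> carrier (ext_alg R n)"
  shows "os_proj R n H f = \<zero>\<^bsub>os_alg R n H\<^esub> \<longleftrightarrow> f \<in> os_ideal R n H"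
proof -
  interpret E: ring "ext_alg R n" by (rule ring_ext_alg)
  show ?thesis
    using ideal.rcos_const_imp_mem[OF ideal_os_ideal assms] E.a_rcos_zero[OF ideal_os_ideal]
    by (auto simp: os_proj_def os_alg_def FactRing_def)
qed

lemma os_vec_eq_proj:
  assumes "v \<in> {1..n} \<rightarrow> carrier R"
  shows "os_vec R n H v = os_proj R n H (ext_vec n v)"
proof -
  interpret pi: ring_hom_ring "ext_alg R n" "os_alg R n H" "os_proj R n H"
    by (rule os_proj_ring_hom)
  have v: "v i \<in> carrier R" if "i \<in> {1..n}" for i using assms that by auto
  have "os_proj R n H (ext_vec n v) =
      (\<Oplus>\<^bsub>os_alg R n H\<^esub>i\<in>{1..n}. os_proj R n H (ext_scalar R n (v i) \<otimes>\<^bsub>ext_alg R n\<^esub> ext_gen R n i))"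
    unfolding ext_vec_def using v by (intro pi.hom_finsum) (auto intro!: pi.R.m_closed)
  also have "\<dots> = os_vec R n H v"
    unfolding os_vec_def os_gen_def
    by (intro pi.S.finsum_cong') (use v in \<open>auto simp del: atLeastAtMost_iff intro!: pi.S.m_closed\<close>)
  finally show ?thesis ..
qed

text \<open>The product of the lifts lies in the Orlik-Solomon ideal, hence in the contraction
  kernel. The lifts have no constant term, so its contraction is the difference of the two
  sides.\<close>

lemma os_vec_mult_imp_line_condition:
  assumes arr: "arrangement n H"
    and v: "v \<in> {1..n} \<rightarrow> carrier R" and w: "w \<in> {1..n} \<rightarrow> carrier R"
    and zero: "os_vec R n H v \<otimes>\<^bsub>os_alg R n H\<^esub> os_vec R n H w = \<zero>\<^bsub>os_alg R n H\<^esub>"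
    and X: "X \<in> lines n H" "i \<in> X"
  shows "vec_sum R X v \<otimes> w i = vec_sum R X w \<otimes> v i"
proof -
  interpret pi: ring_hom_ring "ext_alg R n" "os_alg R n H" "os_proj R n H"
    by (rule os_proj_ring_hom)
  have sub: "X \<subseteq> {1..n}" using lines_subset[OF arr X(1)] .
  then have vw: "v j \<in> carrier R" "w j \<in> carrier R" "ext_vec n v {j} = v j" "ext_vec n w {j} = w j"
    if "j \<in> X" for j
    using that v w by (auto intro!: ext_vec_singleton)
  note cl = ext_vec_carrier[OF v] ext_vec_carrier[OF w]
  have "os_proj R n H (ext_vec n v \<otimes>\<^bsub>ext_alg R n\<^esub> ext_vec n w) = \<zero>\<^bsub>os_alg R n H\<^esub>"
    using zero cl by (simp add: os_vec_eq_proj[OF v] os_vec_eq_proj[OF w])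
  then have "ext_vec n v \<otimes>\<^bsub>ext_alg R n\<^esub> ext_vec n w \<in> contract_kernel n (lines n H)"
    using cl os_ideal_subset_contract_kernel[OF arr] by (subst (asm) os_proj_eq_zero_iff) auto
  then have "ext_contract X i (ext_vec n v \<otimes>\<^bsub>ext_alg R n\<^esub> ext_vec n w) = \<zero>"
    using X by (simp add: contract_kernel_def)
  moreover have "(\<Oplus>j\<in>X. ext_vec n v {j}) = vec_sum R X v" "(\<Oplus>j\<in>X. ext_vec n w {j}) = vec_sum R X w"
    unfolding vec_sum_def using vw by (auto intro!: finsum_cong')
  moreover have s: "vec_sum R X v \<in> carrier R" "vec_sum R X w \<in> carrier R"
    unfolding vec_sum_def using vw by (auto intro!: finsum_closed)
  ultimately have "v i \<otimes> vec_sum R X w \<ominus> vec_sum R X v \<otimes> w i = \<zero>"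
    using vw[OF X(2)] ext_contract_closed[OF cl(1) sub X(2)] ext_contract_closed[OF cl(2) sub X(2)]
    by (simp add: ext_contract_mult[OF cl sub X(2)] ext_vec_empty[OF v] ext_vec_empty[OF w])
  then show ?thesis
    using s vw[OF X(2)] by (simp add: r_right_minus_eq m_comm[of "v i"])
qed

text \<open>The relation a_i a_j + a_j a_m + a_m a_i = 0, rearranged by anticommutation. The indices
  may coincide; then it follows from anticommutation and vanishing squares.\<close>

lemma os_gen_pencil:
  assumes arr: "arrangement n H" and X: "X \<in> lines n H"
    and ijk: "i \<in> X" "j \<in> X" "m \<in> X"
  defines "A \<equiv> os_alg R n H" and "a \<equiv> os_gen R n H"
  shows "a i \<otimes>\<^bsub>A\<^esub> a j = (a i \<ominus>\<^bsub>A\<^esub> a j) \<otimes>\<^bsub>A\<^esub> a m"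
proof -
  interpret pi: ring_hom_ring "ext_alg R n" A "os_proj R n H"
    unfolding A_def by (rule os_proj_ring_hom)
  have sub: "X \<subseteq> {1..n}" using lines_subset[OF arr X] .
  have a [simp]: "a p \<in> carrier A" for p
    by (simp add: a_def os_gen_def)
  have sq: "a p \<otimes>\<^bsub>A\<^esub> a p = \<zero>\<^bsub>A\<^esub>" if "p \<in> X" for p
    using ext_gen_square[of p n] that sub unfolding a_def os_gen_def
    by (simp flip: pi.hom_mult add: subset_iff)
  have anti: "a p \<otimes>\<^bsub>A\<^esub> a q = \<ominus>\<^bsub>A\<^esub> (a q \<otimes>\<^bsub>A\<^esub> a p)" if "p \<in> X" "q \<in> X" for p q
  proof (rule pi.S.minus_equality[symmetric])
    have "p \<in> {1..n}" "q \<in> {1..n}" using that sub by auto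
    then show "a p \<otimes>\<^bsub>A\<^esub> a q \<oplus>\<^bsub>A\<^esub> a q \<otimes>\<^bsub>A\<^esub> a p = \<zero>\<^bsub>A\<^esub>"
      unfolding a_def os_gen_def
      by (simp flip: pi.hom_mult pi.hom_add add: ext_gen_anticomm)
  qed auto
  \<comment> \<open>\<open>T\<close> is alternating, so it suffices that it vanishes on increasing triples.\<close>
  define T where "T p q r = a p \<otimes>\<^bsub>A\<^esub> a q \<oplus>\<^bsub>A\<^esub> a q \<otimes>\<^bsub>A\<^esub> a r \<oplus>\<^bsub>A\<^esub> a r \<otimes>\<^bsub>A\<^esub> a p" for p q r
  have sorted: "T p q r = \<zero>\<^bsub>A\<^esub>" if pqr: "p \<in> X" "q \<in> X" "r \<in> X" "p < q" "q < r" for p q r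
  proof -
    have n: "p \<in> {1..n}" "q \<in> {1..n}" "r \<in> {1..n}" using pqr sub by auto
    have "circuit n H {p, q, r}"
      using pqr by (intro circuit_triple_of_line[OF arr X]) auto
    then have "ext_boundary R n {p, q, r} \<in> os_ideal R n H"
      unfolding os_ideal_def
      by (intro subsetD[OF pi.R.genideal_self] imageI)
        (auto simp: ext_boundary_def neg_one_pow_def ext_monom_carrier intro!: pi.R.finsum_closed)
    then have "os_proj R n H (ext_boundary R n {p, q, r}) = \<zero>\<^bsub>A\<^esub>"
      unfolding A_def using n pqr
      by (subst os_proj_eq_zero_iff) (auto simp: ext_boundary_triple)
    then show ?thesis
      unfolding T_def a_def os_gen_def using n pqr by (simp add: ext_boundary_triple)
  qed
  have rot: "T p q r = T q r p" for p q r
    unfolding T_def by (simp add: pi.S.a_ac)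
  have swap: "T p q r = \<ominus>\<^bsub>A\<^esub> T q p r" if "p \<in> X" "q \<in> X" "r \<in> X" for p q r
    unfolding T_def using that anti[of p q] anti[of q r] anti[of r p]
    by (simp add: pi.S.minus_add pi.S.a_ac)
  have T: "T p q r = \<zero>\<^bsub>A\<^esub>" if pqr: "p \<in> X" "q \<in> X" "r \<in> X" for p q r
  proof -
    have rep: "T p p r = \<zero>\<^bsub>A\<^esub>" if "p \<in> X" "r \<in> X" for p r
      unfolding T_def using that sq anti[of p r] by (simp add: pi.S.l_neg)
    \<comment> \<open>With the smallest index in front, only the order of the other two is open. If
      \<open>r < q\<close>, a swap followed by a rotation leads to the increasing triple
      \<open>p\<close>, \<open>r\<close>, \<open>q\<close>.\<close>
    have lt: "T p q r = \<zero>\<^bsub>A\<^esub>" if "p \<in> X" "q \<in> X" "r \<in> X" "p < q" "p < r" for p q r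
    proof -
      consider "q < r" | "q = r" | "r < q" by linarith
      then show ?thesis
      proof cases
        case 1
        then show ?thesis using sorted that by simp
      next
        case 2
        then show ?thesis using rep[of q p] rot[of p q r] that by simp
      next
        case 3
        then show ?thesis
          using sorted[of p r q] swap[of q p r] swap[of p q r] rot[of q p r] that by simp
      qed
    qed
    \<comment> \<open>Either two indices agree, or there is a strict minimum, which a rotation
      brings to the front.\<close>
    consider "p = q" | "q = r" | "r = p" | "p < q" "p < r" | "q < p" "q < r" | "r < p" "r < q"
      by linarith
    then show ?thesis
    proof cases
      case 1 then show ?thesis using rep pqr by simp
    next
      case 2 then show ?thesis using rep rot pqr by metis
    next
      case 3 then show ?thesis using rep rot pqr by metis
    next
      case 4 then show ?thesis using lt pqr by simp
    next
      case 5 then show ?thesis using lt rot pqr by metis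
    next
      case 6 then show ?thesis using lt rot pqr by metis
    qed
  qed
  have "a i \<otimes>\<^bsub>A\<^esub> a j \<oplus>\<^bsub>A\<^esub> (a j \<otimes>\<^bsub>A\<^esub> a m \<oplus>\<^bsub>A\<^esub> a m \<otimes>\<^bsub>A\<^esub> a i) = \<zero>\<^bsub>A\<^esub>"
    using T[of i j m] ijk by (simp add: T_def pi.S.a_assoc)
  then have "a i \<otimes>\<^bsub>A\<^esub> a j = \<ominus>\<^bsub>A\<^esub> (a j \<otimes>\<^bsub>A\<^esub> a m \<oplus>\<^bsub>A\<^esub> a m \<otimes>\<^bsub>A\<^esub> a i)"
    by (intro pi.S.minus_equality[symmetric]) auto
  also have "\<dots> = (a i \<ominus>\<^bsub>A\<^esub> a j) \<otimes>\<^bsub>A\<^esub> a m"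
    using anti[of m i] ijk by (simp add: pi.S.minus_eq pi.S.minus_add pi.S.l_distr pi.S.l_minus pi.S.a_ac)
  finally show ?thesis .
qed

text \<open>Since each pair of distinct indices lies on exactly one line and squares vanish, the
  product is a sum over lines of products of restricted vectors. Each of these vanishes by the
  pencil computation.\<close>

lemma line_condition_imp_os_vec_mult:
  assumes arr: "arrangement n H"
    and v: "v \<in> {1..n} \<rightarrow> carrier R" and w: "w \<in> {1..n} \<rightarrow> carrier R"
    and lines: "\<And>X i. X \<in> lines n H \<Longrightarrow> i \<in> X \<Longrightarrow> vec_sum R X v \<otimes> w i = vec_sum R X w \<otimes> v i"
  shows "os_vec R n H v \<otimes>\<^bsub>os_alg R n H\<^esub> os_vec R n H w = \<zero>\<^bsub>os_alg R n H\<^esub>"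
proof -
  define A a s where "A = os_alg R n H" and "a = os_gen R n H"
    and "s r = os_proj R n H (ext_scalar R n r)" for r
  interpret pi: ring_hom_ring "ext_alg R n" A "os_proj R n H"
    unfolding A_def by (rule os_proj_ring_hom)
  interpret sc: ring_hom_ring R "ext_alg R n" "ext_scalar R n"
    by (rule ext_scalar_ring_hom)
  \<comment> \<open>The composite of the two homomorphisms embeds no more than the image of
    \<open>R\<close>, but it carries the equations on the lines into \<open>A\<close>, where scalars
    commute with the generators.\<close>
  interpret s: ring_hom_ring R A s
    by (intro ring_hom_ringI) (auto simp: s_def ring_axioms pi.S.ring_axioms)
  have a [simp]: "a i \<in> carrier A" for i by (simp add: a_def os_gen_def)
  have comm: "a i \<otimes>\<^bsub>A\<^esub> s r = s r \<otimes>\<^bsub>A\<^esub> a i" if "r \<in> carrier R" for i r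
    using that by (simp add: a_def os_gen_def s_def ext_scalar_commute flip: pi.hom_mult)
  have sq: "a i \<otimes>\<^bsub>A\<^esub> a i = \<zero>\<^bsub>A\<^esub>" if "i \<in> {1..n}" for i
    using ext_gen_square[OF that] unfolding a_def os_gen_def by (simp flip: pi.hom_mult)
  have cl [simp]: "v i \<in> carrier R" "w i \<in> carrier R" if "i \<in> {1..n}" for i
    using that v w by auto
  have os_vec: "os_vec R n H u = (\<Oplus>\<^bsub>A\<^esub>i\<in>{1..n}. s (u i) \<otimes>\<^bsub>A\<^esub> a i)" for u
    by (simp add: os_vec_def A_def a_def s_def)
  have "os_vec R n H v \<otimes>\<^bsub>A\<^esub> os_vec R n H w =
    (\<Oplus>\<^bsub>A\<^esub>X\<in>lines n H. (\<Oplus>\<^bsub>A\<^esub>i\<in>X. s (v i) \<otimes>\<^bsub>A\<^esub> a i) \<otimes>\<^bsub>A\<^esub> (\<Oplus>\<^bsub>A\<^esub>i\<in>X. s (w i) \<otimes>\<^bsub>A\<^esub> a i))"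
    unfolding os_vec
  proof (rule pi.S.finsum_product_linear_space)
    show "s (v i) \<otimes>\<^bsub>A\<^esub> a i \<otimes>\<^bsub>A\<^esub> (s (w i) \<otimes>\<^bsub>A\<^esub> a i) = \<zero>\<^bsub>A\<^esub>" if i: "i \<in> {1..n}" for i
    proof -
      have "s (v i) \<otimes>\<^bsub>A\<^esub> a i \<otimes>\<^bsub>A\<^esub> (s (w i) \<otimes>\<^bsub>A\<^esub> a i) = s (v i) \<otimes>\<^bsub>A\<^esub> (a i \<otimes>\<^bsub>A\<^esub> s (w i)) \<otimes>\<^bsub>A\<^esub> a i"
        using cl[OF i] by (simp add: pi.S.m_assoc)
      also have "\<dots> = s (v i) \<otimes>\<^bsub>A\<^esub> s (w i) \<otimes>\<^bsub>A\<^esub> (a i \<otimes>\<^bsub>A\<^esub> a i)"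
        using cl[OF i] by (simp add: comm pi.S.m_assoc)
      finally show ?thesis using cl[OF i] sq[OF i] by simp
    qed
    show "\<exists>X\<in>lines n H. i \<in> X \<and> j \<in> X" if "i \<in> {1..n}" "j \<in> {1..n}" "i \<noteq> j" for i j
      using line_through[OF arr that] by blast
    show "X = Y" if "X \<in> lines n H" "Y \<in> lines n H" "i \<in> X \<inter> Y" "j \<in> X \<inter> Y" "i \<noteq> j" for X Y i j
      using lines_Int_unique[OF arr that] .
    show "X \<subseteq> {1..n}" if "X \<in> lines n H" for X
      using lines_subset[OF arr that] .
  qed (auto simp del: atLeastAtMost_iff)
  also have "\<dots> = \<zero>\<^bsub>A\<^esub>"
  proof (rule pi.S.add.finprod_one_eqI)
    fix X assume X: "X \<in> lines n H"
    \<comment> \<open>Any index of the line can serve as the fixed right factor.\<close>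
    then obtain m where m: "m \<in> X" using card_line_ge[OF arr X] by fastforce
    have sub: "i \<in> {1..n}" if "i \<in> X" for i using lines_subset[OF arr X] that by auto
    have sum: "(\<Oplus>\<^bsub>A\<^esub>i\<in>X. s (u i)) = s (vec_sum R X u)" if "u \<in> {1..n} \<rightarrow> carrier R" for u
      unfolding vec_sum_def
      using that sub finite_line[OF arr X] by (intro s.hom_finsum[symmetric]) auto
    have vs: "vec_sum R X v \<in> carrier R" "vec_sum R X w \<in> carrier R"
      unfolding vec_sum_def using sub by (auto intro!: finsum_closed)
    show "(\<Oplus>\<^bsub>A\<^esub>i\<in>X. s (v i) \<otimes>\<^bsub>A\<^esub> a i) \<otimes>\<^bsub>A\<^esub> (\<Oplus>\<^bsub>A\<^esub>i\<in>X. s (w i) \<otimes>\<^bsub>A\<^esub> a i) = \<zero>\<^bsub>A\<^esub>"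
    proof (rule pi.S.finsum_product_pencil[OF finite_line[OF arr X] m])
      show "a i \<otimes>\<^bsub>A\<^esub> a j = (a i \<ominus>\<^bsub>A\<^esub> a j) \<otimes>\<^bsub>A\<^esub> a m" if "i \<in> X" "j \<in> X" for i j
        using os_gen_pencil[OF arr X that m] by (simp add: A_def a_def)
      fix i assume i: "i \<in> X"
      show "(\<Oplus>\<^bsub>A\<^esub>i\<in>X. s (v i)) \<otimes>\<^bsub>A\<^esub> s (w i) = (\<Oplus>\<^bsub>A\<^esub>i\<in>X. s (w i)) \<otimes>\<^bsub>A\<^esub> s (v i)"
        using lines[OF X i] vs cl[OF sub[OF i]] by (simp add: sum[OF v] sum[OF w] flip: s.hom_mult)
      show "s (v i) \<otimes>\<^bsub>A\<^esub> (\<Oplus>\<^bsub>A\<^esub>i\<in>X. s (w i)) = (\<Oplus>\<^bsub>A\<^esub>i\<in>X. s (w i)) \<otimes>\<^bsub>A\<^esub> s (v i)"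
        using vs cl[OF sub[OF i]] by (simp add: sum[OF w] m_comm flip: s.hom_mult)
    qed (use sub cl in \<open>auto simp: comm simp del: atLeastAtMost_iff\<close>)
  qed
  finally show ?thesis by (simp add: A_def)
qed

text \<open>Sum the vanishing minors for \<open>j\<close> and the fixed \<open>i\<close> over all
  \<open>j\<close> in \<open>X\<close>.\<close>

lemma parallel_imp_vec_sum_mult:
  assumes "finite X" "v \<in> X \<rightarrow> carrier R" "w \<in> X \<rightarrow> carrier R" "parallel R X v w" "i \<in> X"
  shows "vec_sum R X v \<otimes> w i = vec_sum R X w \<otimes> v i"
proof -
  have cl: "v j \<in> carrier R" "w j \<in> carrier R" if "j \<in> X" for j
    using that assms by auto
  have eq: "v j \<otimes> w i = w j \<otimes> v i" if "j \<in> X" for j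
    using assms(4,5) cl that by (simp add: parallel_def r_right_minus_eq m_comm)
  have "vec_sum R X v \<otimes> w i = (\<Oplus>j\<in>X. v j \<otimes> w i)"
    unfolding vec_sum_def using assms cl by (intro finsum_ldistr) auto
  also have "\<dots> = (\<Oplus>j\<in>X. w j \<otimes> v i)"
    using assms(5) cl eq by (intro finsum_cong') auto
  also have "\<dots> = vec_sum R X w \<otimes> v i"
    unfolding vec_sum_def using assms cl by (intro finsum_ldistr[symmetric]) auto
  finally show ?thesis .
qed

text \<open>In the equation at \<open>p\<close> the term \<open>v p \<otimes> w p\<close> occurs on
  both sides; cancelling it leaves the only minor there is on two indices.\<close>

lemma vec_sum_mult_imp_parallel:
  assumes X: "card X = 2" and v: "v \<in> X \<rightarrow> carrier R" and w: "w \<in> X \<rightarrow> carrier R"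
    and eq: "\<And>i. i \<in> X \<Longrightarrow> vec_sum R X v \<otimes> w i = vec_sum R X w \<otimes> v i"
  shows "parallel R X v w"
proof -
  obtain p q where pq: "X = {p, q}" "p \<noteq> q" using X by (auto simp: card_2_iff)
  have cl: "v p \<in> carrier R" "v q \<in> carrier R" "w p \<in> carrier R" "w q \<in> carrier R"
    using v w pq by auto
  have "v p \<otimes> w p \<oplus> v q \<otimes> w p = v p \<otimes> w p \<oplus> v p \<otimes> w q"
    using eq[of p] cl pq
    by (simp add: vec_sum_def l_distr m_comm[of "w p" "v p"] m_comm[of "w q" "v p"])
  then have "v q \<otimes> w p = v p \<otimes> w q" using cl by simp
  then show ?thesis
    using cl pq by (auto simp: parallel_def r_right_minus_eq)
qed

end

theorem theorem3p5:
  fixes R :: "('r, 'm) ring_scheme"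
    and n :: nat
    and H :: "nat \<Rightarrow> (complex ^ 'l) set"
    and lam eta :: "nat \<Rightarrow> 'r"
  assumes "cring R"
    and "arrangement n H"
    and "lam \<in> {1..n} \<rightarrow>\<^sub>E carrier R"
    and "eta \<in> {1..n} \<rightarrow>\<^sub>E carrier R"
  shows "eta \<in> os_Z R n H lam \<longleftrightarrow>
    (\<forall>X \<in> lines n H.
      parallel R X (restrict lam X) (restrict eta X) \<or>
      X \<in> nontrivial_lines n H \<and>
      vec_smult R X (vec_sum R X lam) (restrict eta X) = vec_smult R X (vec_sum R X eta) (restrict lam X))"
proof -
  interpret cring R by fact
  have lam: "lam \<in> {1..n} \<rightarrow> carrier R" and eta: "eta \<in> {1..n} \<rightarrow> carrier R"
    using assms(3,4) by auto
  have "eta \<in> os_Z R n H lam \<longleftrightarrow>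
      os_vec R n H lam \<otimes>\<^bsub>os_alg R n H\<^esub> os_vec R n H eta = \<zero>\<^bsub>os_alg R n H\<^esub>"
    using assms(4) by (simp add: os_Z_def)
  \<comment> \<open>One equation serves for trivial and nontrivial lines alike; the alternatives (i)
    and (ii) are separated only afterwards, line by line.\<close>
  also have "\<dots> \<longleftrightarrow> (\<forall>X\<in>lines n H. \<forall>i\<in>X.
      vec_sum R X lam \<otimes>\<^bsub>R\<^esub> eta i = vec_sum R X eta \<otimes>\<^bsub>R\<^esub> lam i)"
    using os_vec_mult_imp_line_condition[OF assms(2) lam eta]
      line_condition_imp_os_vec_mult[OF assms(2) lam eta] by blast
  also have "\<dots> \<longleftrightarrow> (\<forall>X \<in> lines n H.
      parallel R X (restrict lam X) (restrict eta X) \<or>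
      X \<in> nontrivial_lines n H \<and>
      vec_smult R X (vec_sum R X lam) (restrict eta X) = vec_smult R X (vec_sum R X eta) (restrict lam X))"
  proof (intro ball_cong refl)
    fix X assume X: "X \<in> lines n H"
    have fin: "finite X" and sub: "X \<subseteq> {1..n}"
      using finite_line[OF assms(2) X] lines_subset[OF assms(2) X] .
    have cl: "lam \<in> X \<rightarrow> carrier R" "eta \<in> X \<rightarrow> carrier R" using lam eta sub by auto
    have "parallel R X (restrict lam X) (restrict eta X) \<longleftrightarrow> parallel R X lam eta"
      by (simp add: parallel_def)
    moreover have "vec_smult R X (vec_sum R X lam) (restrict eta X) =
        vec_smult R X (vec_sum R X eta) (restrict lam X) \<longleftrightarrow>
      (\<forall>i\<in>X. vec_sum R X lam \<otimes>\<^bsub>R\<^esub> eta i = vec_sum R X eta \<otimes>\<^bsub>R\<^esub> lam i)"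
      by (auto simp: vec_smult_def fun_eq_iff restrict_def)
    \<comment> \<open>For \<open>card X = 2\<close> alternative (ii) is excluded, and the equation
      amounts to parallelism. For any other line the equation is (ii), and (i) implies it.\<close>
    ultimately show "(\<forall>i\<in>X. vec_sum R X lam \<otimes>\<^bsub>R\<^esub> eta i = vec_sum R X eta \<otimes>\<^bsub>R\<^esub> lam i) \<longleftrightarrow>
      parallel R X (restrict lam X) (restrict eta X) \<or>
      X \<in> nontrivial_lines n H \<and>
      vec_smult R X (vec_sum R X lam) (restrict eta X) = vec_smult R X (vec_sum R X eta) (restrict lam X)"
      using X parallel_imp_vec_sum_mult[OF fin cl] vec_sum_mult_imp_parallel[OF _ cl]
      by (auto simp: nontrivial_lines_def)
  qed
  finally show ?thesis .
qed

end
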